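(* Let $p$ be an odd prime, $q$ a power of $p$, $D=\mathbb{F}_n$ a subfield of $\mathbb{F}_q$, let $k,r\ge0$ be integers, $\gamma_1,\gamma_2\in D$, and $f=x^{k+2}+\gamma_1x^{k+1}+\gamma_2x^k$. Then $$N(f,r)=q^{k-r}\binom{n}{r}\sum_{j=0}^{k-r}(-q)^{-j}\binom{n-r}{j}+(-1)^{k+1-r}\frac{1}{n}\binom{n}{r}\binom{n-r}{k+1-r}+(-1)^{k+2-r}\frac{1}{n^2}\binom{n}{r}\binom{n-r}{k+2-r}+E,$$ where $$|E|\le \binom{k+2}{r}A_{k+2}(n,1/\sqrt n)+\sqrt n\binom{k+1}{r}A_{k+1}(n,1/\sqrt n).$$
   Context: $N(f,r)$ is the number of monic polynomials $g$ of degree $k+2$ over $\mathbb{F}_q$ of the form $g=x^{k+2}+\gamma_1x^{k+1}+\gamma_2x^k+(\text{terms of degree}<k)$ such that exactly $r$ elements $\alpha\in D$ satisfy $(x+\alpha)\mid g$. For a nonnegative integer $m$ and real $u,w$, $A_m(u,w)=\sum_{0\le j\le m/p}\binom{uw+m-jp-1}{m-jp}\binom{(u-uw)/p+j-1}{j}$ with generalized binomial coefficients $\binom{x}{i}=x(x-1)\cdots(x-i+1)/i!$. Binomial coefficients with out-of-range lower index are $0$. *)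

theory Defs
  imports Complex_Main "HOL-Library.Cardinality" "HOL-Computational_Algebra.Computational_Algebra"
begin

definition is_subfield :: "'a::field set \<Rightarrow> bool" where
  "is_subfield D \<longleftrightarrow>
     0 \<in> D \<and> 1 \<in> D \<and>
     (\<forall>x\<in>D. \<forall>y\<in>D. x + y \<in> D \<and> x * y \<in> D) \<and>
     (\<forall>x\<in>D. - x \<in> D \<and> inverse x \<in> D)"

definition binom :: "real \<Rightarrow> int \<Rightarrow> real" where
  "binom x i = (if i < 0 then 0 else x gchoose (nat i))"

text \<open>The zero polynomial has \<open>degree 0 = 0\<close> here, so the condition that \<open>h\<close>
  has only terms of degree below \<open>k\<close> is stated on coefficients; for \<open>k = 0\<close> it forces \<open>h = 0\<close>.\<close>

definition N_count :: "'a::{field,finite} set \<Rightarrow> nat \<Rightarrow> 'a poly \<Rightarrow> nat \<Rightarrow> nat" where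
  "N_count D k f r =
     card {g. lead_coeff g = 1 \<and> degree g = k + 2 \<and>
              (\<exists>h. g = f + h \<and> (\<forall>i\<ge>k. coeff h i = 0)) \<and>
              card {\<alpha> \<in> D. [:\<alpha>, 1:] dvd g} = r}"

definition A_sum :: "nat \<Rightarrow> nat \<Rightarrow> real \<Rightarrow> real \<Rightarrow> real" where
  "A_sum p m u w =
     (\<Sum>j | real j \<le> real m / real p.
        binom (u * w + real m - real j * real p - 1) (int m - int j * int p) *
        binom ((u - u * w) / real p + real j - 1) (int j))"

end

theory Submission
  imports Defs "HOL-Number_Theory.Cong"
begin

text \<open>
  Inclusion-exclusion over the sets \<open>S \<subseteq> D\<close> of forced roots reduces \<open>N(f, r)\<close> to the number of
  admissible \<open>g\<close> divisible by \<open>\<Prod>\<alpha>\<in>S. (x + \<alpha>)\<close>. For \<open>card S \<le> k\<close> this number is \<open>q^(k - card S)\<close>.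
  For \<open>card S = k + 1\<close> and \<open>card S = k + 2\<close> it is 0 or 1, and since \<open>p\<close> is odd it depends only on
  the power sums \<open>\<Sum>x\<in>S. x\<close> and \<open>\<Sum>x\<in>S. x\<^sup>2\<close>: they must form a fixed point, respectively lie on a
  fixed parabola. Fourier inversion on \<open>D \<times> D\<close> expresses the number of such \<open>S\<close> through the
  elementary symmetric functions of the values \<open>\<psi> (a x + b x\<^sup>2)\<close>, \<open>x \<in> D\<close>. The pair
  \<open>(a, b) = (0, 0)\<close> gives the main term. For the others the \<open>i\<close>-th power sum of these values is a
  quadratic Gauss sum, of modulus at most \<open>sqrt n\<close> unless \<open>p\<close> divides \<open>i\<close>, so comparing Newton's
  identities with the logarithmic derivative of
  \<open>(1 - z)^(- sqrt n) (1 - z^p)^(- (n - sqrt n) / p)\<close> bounds the symmetric functions by \<open>A_sum\<close>.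
\<close>

section \<open>Elementary symmetric functions and power sums\<close>

definition elem_sym :: "('a \<Rightarrow> 'b::comm_ring_1) \<Rightarrow> 'a set \<Rightarrow> nat \<Rightarrow> 'b" where
  "elem_sym \<chi> D m = (\<Sum>S | S \<subseteq> D \<and> card S = m. \<Prod>x\<in>S. \<chi> x)"

lemma prod_linear_nth_eq_elem_sym:
  fixes \<chi> :: "'a \<Rightarrow> 'b::comm_ring_1"
  assumes "finite D"
  shows "(\<Prod>x\<in>D. 1 + fps_const (\<chi> x) * fps_X) $ m = elem_sym \<chi> D m"
proof -
  have "(\<Prod>x\<in>D. 1 + fps_const (\<chi> x) * fps_X) =
      (\<Sum>S\<in>Pow D. \<Prod>x\<in>S. fps_const (\<chi> x) * fps_X)"
    using prod_add[OF assms, of "\<lambda>x. fps_const (\<chi> x) * fps_X" "\<lambda>_. 1"] by (simp add: add.commute)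
  also have "\<dots> = (\<Sum>S\<in>Pow D. fps_const (\<Prod>x\<in>S. \<chi> x) * fps_X ^ card S)"
  proof (rule sum.cong[OF refl])
    fix S assume "S \<in> Pow D"
    then have "finite S" using assms finite_subset by blast
    then show "(\<Prod>x\<in>S. fps_const (\<chi> x) * fps_X) = fps_const (\<Prod>x\<in>S. \<chi> x) * fps_X ^ card S"
      by (induction S) (simp_all add: fps_const_mult[symmetric] mult_ac del: fps_const_mult)
  qed
  finally have "(\<Prod>x\<in>D. 1 + fps_const (\<chi> x) * fps_X) $ m
      = (\<Sum>S\<in>Pow D. if card S = m then \<Prod>x\<in>S. \<chi> x else 0)"
    by (auto simp: fps_sum_nth fps_X_power_iff intro!: sum.cong)
  also have "\<dots> = elem_sym \<chi> D m"
    unfolding elem_sym_def using assms by (subst sum.inter_filter[symmetric]) (auto intro!: sum.cong)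
  finally show ?thesis .
qed

lemma X_deriv_nth: "(fps_X * fps_deriv F) $ m = of_nat m * F $ m"
  for F :: "'b::comm_ring_1 fps"
  by (cases m) simp_all

text \<open>The series is c z / (1 + c z), that is, z times the logarithmic derivative of 1 + c z.
  The product form avoids division and so makes sense over any commutative ring.\<close>

lemma linear_log_deriv:
  fixes c :: "'b::comm_ring_1"
  shows "(1 + fps_const c * fps_X) * Abs_fps (\<lambda>i. if i = 0 then 0 else (-1) ^ (i - 1) * c ^ i)
    = fps_const c * fps_X"
proof (rule fps_ext)
  fix i
  show "((1 + fps_const c * fps_X) * Abs_fps (\<lambda>i. if i = 0 then 0 else (-1) ^ (i - 1) * c ^ i)) $ i
      = (fps_const c * fps_X) $ i"
  proof (cases i)
    case (Suc j)
    then show ?thesis by (cases j) (simp_all add: distrib_right mult.assoc)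
  qed (simp add: distrib_right mult.assoc)
qed

text \<open>Logarithmic derivatives add over products, so summing the series of
  \<open>linear_log_deriv\<close> over \<open>D\<close> produces the signed power sums.\<close>

lemma X_deriv_prod_linear:
  fixes \<chi> :: "'a \<Rightarrow> 'b::comm_ring_1"
  assumes "finite D"
  shows "fps_X * fps_deriv (\<Prod>x\<in>D. 1 + fps_const (\<chi> x) * fps_X) =
    (\<Prod>x\<in>D. 1 + fps_const (\<chi> x) * fps_X) *
      Abs_fps (\<lambda>i. if i = 0 then 0 else (-1) ^ (i - 1) * (\<Sum>x\<in>D. \<chi> x ^ i))"
  using assms
proof (induction D)
  case empty
  have "Abs_fps (\<lambda>i. 0 :: 'b) = 0" by (rule fps_ext) simp
  then show ?case by (simp cong: if_cong)
next
  case (insert y D)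
  let ?l = "\<lambda>x. 1 + fps_const (\<chi> x) * fps_X"
  let ?L = "\<lambda>x. Abs_fps (\<lambda>i. if i = 0 then 0 else (-1) ^ (i - 1) * \<chi> x ^ i)"
  let ?P = "\<lambda>D. Abs_fps (\<lambda>i. if i = 0 then 0 else (-1) ^ (i - 1) * (\<Sum>x\<in>D. \<chi> x ^ i))"
  have "?P (insert y D) = ?L y + ?P D"
    using insert.hyps by (intro fps_ext) (simp add: distrib_left)
  moreover have "fps_X * fps_deriv (prod ?l (insert y D))
      = fps_X * fps_const (\<chi> y) * prod ?l D + ?l y * (fps_X * fps_deriv (prod ?l D))"
    using insert.hyps by (simp add: algebra_simps)
  moreover have "fps_X * fps_const (\<chi> y) = ?l y * ?L y"
    using linear_log_deriv[of "\<chi> y"] by (simp add: mult.commute)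
  ultimately have "fps_X * fps_deriv (prod ?l (insert y D))
      = ?l y * ?L y * prod ?l D + ?l y * (prod ?l D * ?P D)"
    by (simp only: insert.IH)
  also have "\<dots> = ?l y * prod ?l D * (?L y + ?P D)"
    by (simp only: distrib_left mult_ac)
  also have "\<dots> = prod ?l (insert y D) * ?P (insert y D)"
    using insert.hyps \<open>?P (insert y D) = ?L y + ?P D\<close> by (simp only: prod.insert not_False_eq_True)
  finally show ?case .
qed

text \<open>Newton's identities: both sides are the coefficient of z^m in z E'(z), where E is the
  product of the factors 1 + \<chi>(x) z.\<close>

lemma newton_identity:
  fixes \<chi> :: "'a \<Rightarrow> 'b::comm_ring_1"
  assumes "finite D"
  shows "of_nat m * elem_sym \<chi> D m =
    (\<Sum>i=1..m. (-1) ^ (i - 1) * (\<Sum>x\<in>D. \<chi> x ^ i) * elem_sym \<chi> D (m - i))"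
proof -
  let ?E = "\<Prod>x\<in>D. 1 + fps_const (\<chi> x) * fps_X"
  let ?P = "Abs_fps (\<lambda>i. if i = 0 then 0 else (-1) ^ (i - 1) * (\<Sum>x\<in>D. \<chi> x ^ i))"
  have "of_nat m * elem_sym \<chi> D m = (fps_X * fps_deriv ?E) $ m"
    by (simp only: X_deriv_nth prod_linear_nth_eq_elem_sym[OF assms])
  also have "\<dots> = (?P * ?E) $ m"
    by (simp only: X_deriv_prod_linear[OF assms] mult.commute[of ?E])
  also have "\<dots> = (\<Sum>i=0..m. ?P $ i * elem_sym \<chi> D (m - i))"
    by (simp add: fps_mult_nth prod_linear_nth_eq_elem_sym[OF assms])
  also have "\<dots> = (\<Sum>i=1..m. ?P $ i * elem_sym \<chi> D (m - i))"
    by (intro sum.mono_neutral_right) auto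
  finally show ?thesis by simp
qed

text \<open>Taking norms in Newton's identities drops the signs and replaces the power sums by their
  bounds \<open>c\<close>. Since \<open>a\<close> satisfies the resulting recurrence with equality,
  strong induction on \<open>m\<close> shows that it is a majorant.\<close>

lemma norm_elem_sym_le:
  fixes \<chi> :: "'a \<Rightarrow> complex" and a c :: "nat \<Rightarrow> real"
  assumes "finite D"
    and bound: "\<And>i. i > 0 \<Longrightarrow> norm (\<Sum>x\<in>D. \<chi> x ^ i) \<le> c i"
    and a0: "a 0 = 1"
    and a_rec: "\<And>m. real m * a m = (\<Sum>i=1..m. c i * a (m - i))"
  shows "norm (elem_sym \<chi> D m) \<le> a m"
proof (induction m rule: less_induct)
  case (less m)
  show ?case
  proof (cases "m = 0")
    case True
    have "{S. S \<subseteq> D \<and> card S = 0} = {{}}"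
      using assms(1) finite_subset by fastforce
    then show ?thesis using True a0 by (simp add: elem_sym_def)
  next
    case False
    have "real m * norm (elem_sym \<chi> D m) = norm (of_nat m * elem_sym \<chi> D m)"
      by (simp add: norm_mult)
    also have "\<dots> \<le> (\<Sum>i=1..m. norm (\<Sum>x\<in>D. \<chi> x ^ i) * norm (elem_sym \<chi> D (m - i)))"
      unfolding newton_identity[OF assms(1)]
      by (rule order.trans[OF norm_sum]) (simp add: norm_mult norm_power)
    also have "\<dots> \<le> (\<Sum>i=1..m. c i * a (m - i))"
    proof (intro sum_mono mult_mono)
      fix i assume i: "i \<in> {1..m}"
      then show "norm (\<Sum>x\<in>D. \<chi> x ^ i) \<le> c i" using bound by simp
      then show "0 \<le> c i" by (rule order.trans[OF norm_ge_zero])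
      show "norm (elem_sym \<chi> D (m - i)) \<le> a (m - i)" using less i by simp
    qed auto
    also have "\<dots> = real m * a m" by (simp add: a_rec)
    finally show ?thesis using False by simp
  qed
qed

section \<open>The series (1 - z)^(-u) and the recurrence for \<open>A_sum\<close>\<close>

definition neg_binomial_series :: "real \<Rightarrow> real fps" where
  "neg_binomial_series u = Abs_fps (\<lambda>i. (u + real i - 1) gchoose i)"

text \<open>The sum telescopes by the absorption identity. It is the coefficient form of z F' = F u
  z / (1 - z) for F = (1 - z)^(-u).\<close>

lemma sum_neg_binomial:
  fixes u :: real
  shows "(\<Sum>l\<le>i. u * ((u + real l - 1) gchoose l)) = real (Suc i) * ((u + real i) gchoose (Suc i))"
proof (induction i)
  case (Suc i)
  have "real (Suc (Suc i)) * ((u + real (Suc i)) gchoose Suc (Suc i))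
      = (u + real (Suc i)) * ((u + real i) gchoose Suc i)"
    using gbinomial_absorption[of "Suc i" "u + real (Suc i)"] by (simp add: algebra_simps)
  then show ?case using Suc by (simp add: algebra_simps)
qed simp

text \<open>The factor on the right is u z / (1 - z), which is z times the logarithmic derivative of
  (1 - z)^(-u).\<close>

lemma X_deriv_neg_binomial_series:
  "fps_X * fps_deriv (neg_binomial_series u) =
    neg_binomial_series u * Abs_fps (\<lambda>i. if i = 0 then 0 else u)"
proof (rule fps_ext)
  fix i
  show "(fps_X * fps_deriv (neg_binomial_series u)) $ i =
    (neg_binomial_series u * Abs_fps (\<lambda>i. if i = 0 then 0 else u)) $ i"
  proof (cases i)
    case (Suc j)
    have "(neg_binomial_series u * Abs_fps (\<lambda>i. if i = 0 then 0 else u)) $ i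
        = (\<Sum>l=0..Suc j. ((u + real l - 1) gchoose l) * (if Suc j - l = 0 then 0 else u))"
      by (simp add: fps_mult_nth neg_binomial_series_def Suc)
    also have "\<dots> = (\<Sum>l\<le>j. u * ((u + real l - 1) gchoose l))"
      by (simp add: atLeast0AtMost mult.commute Suc_diff_le)
    finally show ?thesis
      by (simp add: sum_neg_binomial Suc neg_binomial_series_def)
  qed (simp add: fps_mult_nth)
qed

text \<open>Chain rule: if L is z times the logarithmic derivative of F, then p L(z^p) is the same
  for F(z^p).\<close>

lemma X_deriv_compose_X_power:
  fixes F L :: "real fps"
  assumes "p > 0" and "fps_X * fps_deriv F = F * L"
  shows "fps_X * fps_deriv (F oo fps_X ^ p) = (F oo fps_X ^ p) * (of_nat p * (L oo fps_X ^ p))"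
proof -
  have X0: "(fps_X ^ p :: real fps) $ 0 = 0" using assms(1) by simp
  have "fps_X * fps_deriv (fps_X ^ p) = of_nat p * (fps_X ^ p :: real fps)"
    by (rule fps_ext) (simp add: X_deriv_nth fps_of_nat[symmetric] fps_X_power_iff)
  then have "fps_X * fps_deriv (F oo fps_X ^ p) = of_nat p * ((fps_deriv F oo fps_X ^ p) * fps_X ^ p)"
    by (simp add: fps_compose_deriv[OF X0] mult_ac)
  also have "(fps_deriv F oo fps_X ^ p) * fps_X ^ p = (F * L) oo fps_X ^ p"
    using X0 assms(1) by (simp add: assms(2)[symmetric] fps_compose_mult_distrib mult.commute)
  finally show ?thesis using X0 by (simp add: fps_compose_mult_distrib mult_ac)
qed

text \<open>The generating function of \<open>A_sum p m u w\<close> is \<open>(1 - z)^(- u w) (1 - z^p)^(- (u - u w) / p)\<close>.\<close>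

lemma A_sum_eq_nth:
  assumes "p > 0"
  shows "A_sum p m u w =
    (neg_binomial_series (u * w) * (neg_binomial_series ((u - u * w) / real p) oo fps_X ^ p)) $ m"
proof -
  let ?F = "neg_binomial_series (u * w)" and ?G = "neg_binomial_series ((u - u * w) / real p)"
  have "(?F * (?G oo fps_X ^ p)) $ m = (\<Sum>i=0..m. (?G oo fps_X ^ p) $ i * ?F $ (m - i))"
    by (simp add: fps_mult_nth mult.commute[of ?F])
  also have "\<dots> = (\<Sum>i | i \<le> m \<and> p dvd i. ?G $ (i div p) * ?F $ (m - i))"
    by (rule sum.mono_neutral_cong_right) (auto simp: fps_nth_compose_X_power)
  also have "\<dots> = (\<Sum>j | j * p \<le> m. ?G $ j * ?F $ (m - j * p))"
    using assms by (intro sum.reindex_bij_witness[of _ "\<lambda>j. j * p" "\<lambda>i. i div p"]) auto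
  also have "{j. j * p \<le> m} = {j. real j \<le> real m / real p}"
    using assms by (auto simp: pos_le_divide_eq simp flip: of_nat_mult)
  also have "(\<Sum>j | real j \<le> real m / real p. ?G $ j * ?F $ (m - j * p)) = A_sum p m u w"
    unfolding A_sum_def
  proof (intro sum.cong[OF refl])
    fix j assume "j \<in> {j. real j \<le> real m / real p}"
    then have le: "j * p \<le> m"
      using assms by (simp add: pos_le_divide_eq flip: of_nat_mult)
    then have "int m - int j * int p = int (m - j * p)" by (simp add: of_nat_diff)
    moreover have "real m - real j * real p = real (m - j * p)" using le by (simp add: of_nat_diff)
    ultimately show "?G $ j * ?F $ (m - j * p) =
        binom (u * w + real m - real j * real p - 1) (int m - int j * int p) *
        binom ((u - u * w) / real p + real j - 1) (int j)"
      by (simp add: neg_binomial_series_def binom_def add_diff_eq[symmetric] mult.commute)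
  qed
  finally show ?thesis by simp
qed

lemma A_sum_0:
  assumes "p > 0"
  shows "A_sum p 0 u w = 1"
  using assms by (simp add: A_sum_eq_nth neg_binomial_series_def fps_nth_compose_X_power)

text \<open>In the logarithmic derivative of the generating function, the first factor contributes u
  w at every positive index and the second adds p (u - u w) / p = u - u w at the multiples of p.
  This is the recurrence required by \<open>norm_elem_sym_le\<close>.\<close>

lemma A_sum_recurrence:
  assumes "p > 0"
  shows "real m * A_sum p m u w =
    (\<Sum>i=1..m. (if p dvd i then u else u * w) * A_sum p (m - i) u w)"
proof -
  let ?v = "(u - u * w) / real p"
  let ?F = "neg_binomial_series (u * w)" and ?G = "neg_binomial_series ?v oo fps_X ^ p"
  let ?L = "\<lambda>u. Abs_fps (\<lambda>i. if i = 0 then 0 else u)"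
  let ?M = "?L (u * w) + of_nat p * (?L ?v oo fps_X ^ p)"
  have G: "fps_X * fps_deriv ?G = ?G * (of_nat p * (?L ?v oo fps_X ^ p))"
    by (rule X_deriv_compose_X_power[OF assms X_deriv_neg_binomial_series])
  have "fps_X * fps_deriv (?F * ?G)
      = (fps_X * fps_deriv ?F) * ?G + ?F * (fps_X * fps_deriv ?G)"
    by (simp add: algebra_simps)
  also have "\<dots> = ?M * (?F * ?G)"
    unfolding G X_deriv_neg_binomial_series by (simp add: algebra_simps)
  finally have D: "fps_X * fps_deriv (?F * ?G) = ?M * (?F * ?G)" .
  have M: "?M $ i = (if i = 0 then 0 else if p dvd i then u else u * w)" for i
    using assms by (auto simp: fps_nth_compose_X_power fps_of_nat[symmetric] elim!: dvdE)
  have "real m * A_sum p m u w = (fps_X * fps_deriv (?F * ?G)) $ m"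
    by (simp only: X_deriv_nth A_sum_eq_nth[OF assms])
  also have "\<dots> = (\<Sum>i=0..m. ?M $ i * (?F * ?G) $ (m - i))"
    unfolding D by (rule fps_mult_nth)
  also have "\<dots> = (\<Sum>i=0..m. ?M $ i * A_sum p (m - i) u w)"
    unfolding A_sum_eq_nth[OF assms] ..
  also have "\<dots> = (\<Sum>i=1..m. ?M $ i * A_sum p (m - i) u w)"
    unfolding M by (rule sum.mono_neutral_right) auto
  also have "\<dots> = (\<Sum>i=1..m. (if p dvd i then u else u * w) * A_sum p (m - i) u w)"
    unfolding M by (rule sum.cong) auto
  finally show ?thesis .
qed

section \<open>Additive characters and quadratic Gauss sums\<close>

locale odd_subfield =
  fixes D :: "'a::{field,finite} set" and p :: nat
  assumes prime_p: "prime p" and odd_p: "odd p"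
    and of_nat_p: "of_nat p = (0::'a)"
    and subfield: "is_subfield D"
begin

lemma CHAR_eq: "CHAR('a) = p"
  by (metis prime_p of_nat_p of_nat_eq_0_iff_char_dvd CHAR_not_1' One_nat_def prime_nat_iff)

lemma of_int_eq_0: "of_int c = (0::'a) \<longleftrightarrow> int p dvd c"
  by (simp add: of_int_eq_0_iff_char_dvd CHAR_eq)

lemma of_nat_eq_0: "of_nat c = (0::'a) \<longleftrightarrow> p dvd c"
  by (simp add: of_nat_eq_0_iff_char_dvd CHAR_eq)

lemma two_neq_0: "(2::'a) \<noteq> 0"
proof
  assume "(2::'a) = 0"
  then have "p dvd 2" using of_nat_eq_0[of 2] by simp
  then show False using odd_p prime_p by (metis primes_dvd_imp_eq two_is_prime_nat even_numeral)
qed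

lemma zero_in [simp]: "0 \<in> D" and one_in [simp]: "1 \<in> D"
  and add_in [simp]: "x \<in> D \<Longrightarrow> y \<in> D \<Longrightarrow> x + y \<in> D"
  and mult_in [simp]: "x \<in> D \<Longrightarrow> y \<in> D \<Longrightarrow> x * y \<in> D"
  and minus_in [simp]: "x \<in> D \<Longrightarrow> - x \<in> D"
  and inverse_in: "x \<in> D \<Longrightarrow> inverse x \<in> D"
  using subfield by (auto simp: is_subfield_def)

lemma diff_in [simp]: "x \<in> D \<Longrightarrow> y \<in> D \<Longrightarrow> x - y \<in> D"
  using add_in[of x "- y"] by simp

lemma divide_in: "x \<in> D \<Longrightarrow> y \<in> D \<Longrightarrow> x / y \<in> D"
  by (simp add: divide_inverse inverse_in)

lemma of_nat_in [simp]: "of_nat i \<in> D"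
  by (induction i) simp_all

lemma power_in [simp]: "x \<in> D \<Longrightarrow> x ^ i \<in> D"
  by (induction i) simp_all

lemma numeral_in [simp]: "numeral i \<in> D"
  using of_nat_in[of "numeral i"] by simp

lemma sum_in: "(\<And>x. x \<in> S \<Longrightarrow> h x \<in> D) \<Longrightarrow> sum h S \<in> D"
  by (induction S rule: infinite_finite_induct) simp_all

lemma sum_translate:
  fixes h :: "'a \<Rightarrow> 'b::comm_monoid_add"
  assumes "t \<in> D"
  shows "(\<Sum>x\<in>D. h (x + t)) = (\<Sum>x\<in>D. h x)"
  using assms by (intro sum.reindex_bij_witness[of _ "\<lambda>x. x - t" "\<lambda>x. x + t"]) auto

section \<open>A nontrivial additive character of \<open>D\<close>\<close>

definition complement_subgroup :: "'a set \<Rightarrow> bool" where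
  "complement_subgroup H \<longleftrightarrow> H \<subseteq> D \<and> 0 \<in> H \<and> 1 \<notin> H \<and>
     (\<forall>x\<in>H. \<forall>y\<in>H. x + y \<in> H) \<and> (\<forall>x\<in>H. - x \<in> H)"

lemma subgroup_of_int_mult:
  assumes "0 \<in> H" "\<forall>x\<in>H. \<forall>y\<in>H. x + y \<in> H" "\<forall>x\<in>H. - x \<in> (H::'a set)" "x \<in> H"
  shows "of_int c * x \<in> H"
proof (induction c rule: int_induct[where k = 0])
  case (step2 i)
  have "of_int (i - 1) * x = of_int i * x + - x" by (simp add: algebra_simps)
  then show ?case using step2 assms by metis
qed (use assms in \<open>simp_all add: algebra_simps\<close>)

lemma int_inverse_mod_p:
  assumes "\<not> int p dvd c"
  obtains d where "of_int d * of_int c = (1::'a)"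
proof -
  have "coprime c (int p)"
    using assms prime_p prime_imp_coprime[of "int p" c] by (simp add: coprime_commute)
  then obtain d where "[c * d = 1] (mod int p)" using cong_solve_coprime_int by blast
  then have "int p dvd c * d - 1" by (simp add: cong_iff_dvd_diff)
  then have "of_int (c * d - 1) = (0::'a)" by (simp only: of_int_eq_0)
  then show thesis by (intro that[of d]) (simp add: mult.commute)
qed

text \<open>A subgroup that is maximal among those avoiding 1 is a complement of the prime field in \<open>D\<close>.\<close>

lemma ex_complement_subgroup:
  obtains H where "complement_subgroup H" and "\<And>x. x \<in> D \<Longrightarrow> \<exists>c::int. x - of_int c \<in> H"
proof -
  have "complement_subgroup {0}" by (simp add: complement_subgroup_def)
  moreover have "\<forall>K. complement_subgroup K \<longrightarrow> card K < Suc CARD('a)"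
    by (simp add: card_mono less_Suc_eq_le)
  ultimately obtain H where H: "complement_subgroup H"
    and max: "\<And>K. complement_subgroup K \<Longrightarrow> card K \<le> card H"
    using ex_has_greatest_nat[of complement_subgroup "{0}" card "Suc CARD('a)"] by blast
  note H' = H[unfolded complement_subgroup_def]
  have mult_H: "of_int c * x \<in> H" if "x \<in> H" for c x
    using subgroup_of_int_mult H' that by blast
  have "\<exists>c::int. x - of_int c \<in> H" if x: "x \<in> D" for x
  proof (cases "x \<in> H")
    case True
    then show ?thesis by (intro exI[of _ 0]) simp
  next
    case False
    \<comment> \<open>\<open>K\<close> is the subgroup generated by \<open>H\<close> and
      \<open>x\<close>. It is strictly larger than \<open>H\<close>, so by maximality it must
      contain 1.\<close>
    define K where "K = {h + of_int c * x | h c. h \<in> H}"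
    have of_int_in: "of_int c * x \<in> D" for c
      using subgroup_of_int_mult[of D x c] x by simp
    have KI: "h + of_int c * x \<in> K" if "h \<in> H" for h c using that by (auto simp: K_def)
    have "H \<subseteq> K" using KI[of _ 0] by auto
    moreover have "x \<in> K" using KI[of 0 1] H' by simp
    ultimately have "card H < card K"
      using False by (metis finite psubsetI psubset_card_mono)
    then have "\<not> complement_subgroup K" using max[of K] by auto
    moreover have "K \<subseteq> D" using H' of_int_in by (auto simp: K_def)
    moreover have "0 \<in> K" using \<open>H \<subseteq> K\<close> H' by blast
    moreover have "a + b \<in> K" if "a \<in> K" "b \<in> K" for a b
    proof -
      obtain h c h' c' where *: "a = h + of_int c * x" "b = h' + of_int c' * x" "h \<in> H" "h' \<in> H"
        using \<open>a \<in> K\<close> \<open>b \<in> K\<close> unfolding K_def by blast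
      then have "a + b = (h + h') + of_int (c + c') * x" by (simp add: algebra_simps)
      then show ?thesis using KI[of "h + h'" "c + c'"] * H' by metis
    qed
    moreover have "- a \<in> K" if "a \<in> K" for a
    proof -
      obtain h c where *: "a = h + of_int c * x" "h \<in> H"
        using \<open>a \<in> K\<close> unfolding K_def by blast
      then have "- a = - h + of_int (- c) * x" by (simp add: algebra_simps)
      then show ?thesis using KI[of "- h" "- c"] * H' by simp
    qed
    ultimately have "1 \<in> K" unfolding complement_subgroup_def by blast
    then obtain h c where hc: "1 = h + of_int c * x" "h \<in> H" unfolding K_def by blast
    \<comment> \<open>Otherwise 1 = h would lie in \<open>H\<close>. Hence c has an inverse d modulo
      p, and multiplying 1 = h + c x by d expresses x as the integer d modulo
      \<open>H\<close>.\<close>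
    have "\<not> int p dvd c"
    proof
      assume "int p dvd c"
      then have "of_int c = (0::'a)" by (simp add: of_int_eq_0)
      then show False using hc H' by simp
    qed
    then obtain d where d: "of_int d * of_int c = (1::'a)" by (rule int_inverse_mod_p)
    have "x = of_int d * (of_int c * x)" using d by (simp add: mult.assoc[symmetric])
    also have "of_int c * x = 1 - h" using hc(1) by (simp add: eq_diff_eq add.commute)
    finally have "x - of_int d = of_int (- d) * h" by (simp add: algebra_simps)
    then show ?thesis using mult_H[OF hc(2), of "- d"] by metis
  qed
  then show thesis using that H by blast
qed

text \<open>Every x in \<open>D\<close> is an integer c plus an element of a complement
  \<open>H\<close> of the prime field. The character sends x to e^(2 pi i c / p); it is trivial on
  \<open>H\<close> but not at 1.\<close>

lemma ex_nontrivial_character: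
  obtains \<psi> :: "'a \<Rightarrow> complex"
  where "\<And>x y. x \<in> D \<Longrightarrow> y \<in> D \<Longrightarrow> \<psi> (x + y) = \<psi> x * \<psi> y"
    and "\<And>x. x \<in> D \<Longrightarrow> norm (\<psi> x) = 1" and "\<exists>x\<in>D. \<psi> x \<noteq> 1"
proof -
  obtain H where H: "complement_subgroup H" and ex: "\<And>x. x \<in> D \<Longrightarrow> \<exists>c::int. x - of_int c \<in> H"
    using ex_complement_subgroup by blast
  note H' = H[unfolded complement_subgroup_def]
  define e where "e c = cis (2 * pi * of_int c / real p)" for c :: int
  have p0: "p > 0" using prime_p by (simp add: prime_gt_0_nat)
  have e_add: "e (c + d) = e c * e d" for c d
    by (simp add: e_def cis_mult add_divide_distrib distrib_left)
  have e_p: "e c = 1" if dvd: "int p dvd c" for c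
  proof -
    obtain d where "c = int p * d" using dvd by (elim dvdE)
    then have "e c = cis (2 * pi * of_int d)" using p0 by (simp add: e_def mult_ac)
    also have "\<dots> = 1" by (rule cis_multiple_2pi) simp
    finally show ?thesis .
  qed
  define \<psi> where "\<psi> x = e (SOME c. x - of_int c \<in> H)" for x
  \<comment> \<open>The value does not depend on the chosen c: two choices differ by an integer
    lying in \<open>H\<close>, and unless p divides it, some multiple of it would be 1, which is not
    in \<open>H\<close>.\<close>
  have \<psi>I: "\<psi> x = e c" if "x - of_int c \<in> H" for x c
  proof -
    define d where "d = (SOME c. x - of_int c \<in> H)"
    have "x - of_int d \<in> H" unfolding d_def by (rule someI[of _ c]) (rule that)
    then have "(x - of_int d) + - (x - of_int c) \<in> H" using H' that by blast
    then have "of_int (c - d) \<in> H" by simp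
    have "int p dvd c - d"
    proof (rule ccontr)
      assume "\<not> int p dvd c - d"
      then obtain l where "of_int l * of_int (c - d) = (1::'a)" by (rule int_inverse_mod_p)
      moreover have "of_int l * of_int (c - d) \<in> H"
        using subgroup_of_int_mult[of H "of_int (c - d)" l] H' \<open>of_int (c - d) \<in> H\<close> by blast
      ultimately show False using H' by simp
    qed
    then have "e c = e d" using e_p[of "c - d"] e_add[of "c - d" d] by simp
    then show ?thesis by (simp add: \<psi>_def d_def)
  qed
  show thesis
  proof (rule that[of \<psi>])
    fix x y assume xy: "x \<in> D" "y \<in> D"
    obtain c d where cd: "x - of_int c \<in> H" "y - of_int d \<in> H" using ex xy by blast
    then have "(x - of_int c) + (y - of_int d) \<in> H" using H' by blast
    then have "(x + y) - of_int (c + d) \<in> H" by (simp add: algebra_simps)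
    then show "\<psi> (x + y) = \<psi> x * \<psi> y" using \<psi>I cd e_add by metis
  next
    fix x show "norm (\<psi> x) = 1" by (simp add: \<psi>_def e_def)
  next
    have "\<psi> 1 = e 1" using H' by (intro \<psi>I) simp
    \<comment> \<open>With p > 2 the angle 2 pi / p lies strictly between 0 and pi, so
      \<open>e 1\<close> has positive imaginary part.\<close>
    moreover have "p > 2" using prime_p odd_p by (metis even_numeral le_neq_implies_less prime_ge_2_nat)
    then have "sin (2 * pi / real p) > 0"
      by (intro sin_gt_zero) (simp_all add: field_simps)
    then have "e 1 \<noteq> 1" by (auto simp: e_def complex_eq_iff)
    ultimately show "\<exists>x\<in>D. \<psi> x \<noteq> 1" by (intro bexI[of _ 1]) auto
  qed
qed

end

text \<open>In odd characteristic the power sums s and t carry the same information as the two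
  coefficients below the leading one of the product of the x + \<alpha> over \<alpha> in
  \<open>S\<close>.\<close>

definition power_sum_count :: "'a::comm_ring_1 set \<Rightarrow> nat \<Rightarrow> 'a \<Rightarrow> 'a \<Rightarrow> nat" where
  "power_sum_count D m s t = card {S. S \<subseteq> D \<and> card S = m \<and> (\<Sum>x\<in>S. x) = s \<and> (\<Sum>x\<in>S. x\<^sup>2) = t}"

section \<open>Orthogonality and quadratic Gauss sums\<close>

locale subfield_character = odd_subfield +
  fixes \<psi> :: "'a \<Rightarrow> complex"
  assumes \<psi>_add: "\<And>x y. x \<in> D \<Longrightarrow> y \<in> D \<Longrightarrow> \<psi> (x + y) = \<psi> x * \<psi> y"
    and norm_\<psi>: "\<And>x. x \<in> D \<Longrightarrow> norm (\<psi> x) = 1"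
    and \<psi>_nontrivial: "\<exists>x\<in>D. \<psi> x \<noteq> 1"
begin

lemma \<psi>_0 [simp]: "\<psi> 0 = 1"
  using \<psi>_add[of 0 0] norm_\<psi>[of 0] by auto

lemma cnj_\<psi>:
  assumes "x \<in> D"
  shows "cnj (\<psi> x) = \<psi> (- x)"
proof -
  have "\<psi> x * \<psi> (- x) = 1" using \<psi>_add[of x "- x"] assms by simp
  moreover have "\<psi> x * cnj (\<psi> x) = 1"
    using norm_\<psi>[OF assms] by (simp add: complex_norm_square[symmetric])
  ultimately show ?thesis by (metis mult_cancel_left mult_zero_left zero_neq_one)
qed

lemma \<psi>_power: "x \<in> D \<Longrightarrow> \<psi> x ^ i = \<psi> (of_nat i * x)"
  by (induction i) (simp_all add: \<psi>_add distrib_right)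

lemma \<psi>_sum: "(\<And>x. x \<in> S \<Longrightarrow> h x \<in> D) \<Longrightarrow> \<psi> (sum h S) = (\<Prod>x\<in>S. \<psi> (h x))"
  by (induction S rule: infinite_finite_induct) (simp_all add: \<psi>_add sum_in)

text \<open>Orthogonality: choose y with \<psi>(y) \<noteq> 1. For nonzero c, translating x by y / c
  multiplies the sum by \<psi>(y) without changing it.\<close>

lemma sum_\<psi>:
  assumes "c \<in> D"
  shows "(\<Sum>x\<in>D. \<psi> (c * x)) = (if c = 0 then of_nat (card D) else 0)"
proof (cases "c = 0")
  case False
  obtain y where y: "y \<in> D" "\<psi> y \<noteq> 1" using \<psi>_nontrivial by blast
  have "(\<Sum>x\<in>D. \<psi> (c * x)) = (\<Sum>x\<in>D. \<psi> (c * (x + y / c)))"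
    using sum_translate[of "y / c" "\<lambda>x. \<psi> (c * x)"] y assms by (simp add: divide_in)
  also have "\<dots> = (\<Sum>x\<in>D. \<psi> (c * x) * \<psi> y)"
    using False y assms by (intro sum.cong) (simp_all add: distrib_left \<psi>_add)
  also have "\<dots> = (\<Sum>x\<in>D. \<psi> (c * x)) * \<psi> y" by (simp add: sum_distrib_right)
  finally show ?thesis using y(2) False by simp
qed simp

text \<open>Expand the squared modulus as a double sum over x and y and put x = t + y. The square of
  y cancels, and the sum over y of \<psi>(2 b t y) vanishes unless t = 0, because 2 b \<noteq>
  0.\<close>

lemma norm_gauss_sum:
  assumes "a \<in> D" "b \<in> D" "b \<noteq> 0"
  shows "norm (\<Sum>x\<in>D. \<psi> (a * x + b * x\<^sup>2)) = sqrt (card D)"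
proof -
  let ?S = "\<Sum>x\<in>D. \<psi> (a * x + b * x\<^sup>2)"
  have "complex_of_real ((norm ?S)\<^sup>2) = ?S * cnj ?S" by (rule complex_norm_square)
  also have "\<dots> = (\<Sum>y\<in>D. \<Sum>x\<in>D. \<psi> (a * x + b * x\<^sup>2) * cnj (\<psi> (a * y + b * y\<^sup>2)))"
    unfolding cnj_sum sum_product by (rule sum.swap)
  also have "\<dots> = (\<Sum>y\<in>D. \<Sum>x\<in>D. \<psi> ((a * x + b * x\<^sup>2) + - (a * y + b * y\<^sup>2)))"
  proof (intro sum.cong refl)
    fix y x assume "y \<in> D" "x \<in> D"
    then show "\<psi> (a * x + b * x\<^sup>2) * cnj (\<psi> (a * y + b * y\<^sup>2)) = \<psi> ((a * x + b * x\<^sup>2) + - (a * y + b * y\<^sup>2))"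
      using assms by (subst cnj_\<psi>, simp, subst \<psi>_add[symmetric]) simp_all
  qed
  also have "\<dots> = (\<Sum>y\<in>D. \<Sum>t\<in>D. \<psi> ((a * (t + y) + b * (t + y)\<^sup>2) + - (a * y + b * y\<^sup>2)))"
    by (intro sum.cong refl sum_translate[symmetric])
  also have "\<dots> = (\<Sum>y\<in>D. \<Sum>t\<in>D. \<psi> (a * t + b * t\<^sup>2) * \<psi> (2 * b * t * y))"
    using assms by (intro sum.cong refl) (simp add: \<psi>_add[symmetric] power2_eq_square algebra_simps)
  also have "\<dots> = (\<Sum>t\<in>D. \<psi> (a * t + b * t\<^sup>2) * (\<Sum>y\<in>D. \<psi> (2 * b * t * y)))"
    by (subst sum.swap) (simp add: sum_distrib_left)
  also have "\<dots> = (\<Sum>t\<in>D. if t = 0 then of_nat (card D) else 0)"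
    using assms two_neq_0 by (intro sum.cong refl) (simp add: sum_\<psi>)
  also have "\<dots> = complex_of_real (real (card D))" by simp
  finally have "(norm ?S)\<^sup>2 = real (card D)" by (simp only: of_real_eq_iff)
  then show ?thesis by (metis norm_ge_zero real_sqrt_unique)
qed

lemma norm_gauss_sum_le:
  assumes "a \<in> D" "b \<in> D" "(a, b) \<noteq> (0, 0)"
  shows "norm (\<Sum>x\<in>D. \<psi> (a * x + b * x\<^sup>2)) \<le> sqrt (card D)"
proof (cases "b = 0")
  case True
  then show ?thesis using assms sum_\<psi>[of a] by simp
qed (use assms norm_gauss_sum in auto)

text \<open>An i-th power of the character replaces (a, b) by (i a, i b). This pair is zero exactly
  when p divides i, and then every term is 1; otherwise the Gauss sum bound applies.\<close>

lemma norm_power_sum_le: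
  assumes "a \<in> D" "b \<in> D" "(a, b) \<noteq> (0, 0)"
  shows "norm (\<Sum>x\<in>D. \<psi> (a * x + b * x\<^sup>2) ^ i) \<le> (if p dvd i then card D else sqrt (card D))"
proof -
  have eq: "(\<Sum>x\<in>D. \<psi> (a * x + b * x\<^sup>2) ^ i) = (\<Sum>x\<in>D. \<psi> ((of_nat i * a) * x + (of_nat i * b) * x\<^sup>2))"
    using assms by (intro sum.cong refl) (simp add: \<psi>_power algebra_simps)
  show ?thesis
  proof (cases "p dvd i")
    case True
    then have "of_nat i = (0::'a)" by (simp add: of_nat_eq_0)
    then show ?thesis using eq True by simp
  next
    case False
    then have "of_nat i \<noteq> (0::'a)" by (simp add: of_nat_eq_0)
    then show ?thesis unfolding eq using False assms norm_gauss_sum_le[of "of_nat i * a" "of_nat i * b"] by simp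
  qed
qed

lemma card_D_pos: "card D > 0"
  using zero_in by (metis card_gt_0_iff empty_iff finite)

text \<open>With u = n and w = 1 / sqrt n one has u w = sqrt n, so the coefficients in
  \<open>A_sum_recurrence\<close> are exactly the bounds of
  \<open>norm_power_sum_le\<close>.\<close>

lemma norm_elem_sym_character_le:
  assumes "a \<in> D" "b \<in> D" "(a, b) \<noteq> (0, 0)"
  shows "norm (elem_sym (\<lambda>x. \<psi> (a * x + b * x\<^sup>2)) D m) \<le> A_sum p m (card D) (1 / sqrt (card D))"
proof (rule norm_elem_sym_le[where c = "\<lambda>i. if p dvd i then real (card D) else real (card D) * (1 / sqrt (card D))"])
  have p0: "p > 0" using prime_p by (simp add: prime_gt_0_nat)
  show "A_sum p 0 (card D) (1 / sqrt (card D)) = 1" by (rule A_sum_0[OF p0])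
  show "real m * A_sum p m (card D) (1 / sqrt (card D)) =
      (\<Sum>i=1..m. (if p dvd i then real (card D) else real (card D) * (1 / sqrt (card D))) *
        A_sum p (m - i) (card D) (1 / sqrt (card D)))" for m
    by (rule A_sum_recurrence[OF p0])
  show "norm (\<Sum>x\<in>D. \<psi> (a * x + b * x\<^sup>2) ^ i)
      \<le> (if p dvd i then real (card D) else real (card D) * (1 / sqrt (card D)))" for i
    using norm_power_sum_le[OF assms, of i] by (simp add: real_div_sqrt split: if_splits)
qed simp

section \<open>Fourier inversion for the subset counts\<close>

lemma elem_sym_character:
  assumes "a \<in> D" "b \<in> D"
  shows "elem_sym (\<lambda>x. \<psi> (a * x + b * x\<^sup>2)) D m =
    (\<Sum>S | S \<subseteq> D \<and> card S = m. \<psi> (a * (\<Sum>x\<in>S. x) + b * (\<Sum>x\<in>S. x\<^sup>2)))"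
  unfolding elem_sym_def
proof (intro sum.cong refl)
  fix S assume "S \<in> {S. S \<subseteq> D \<and> card S = m}"
  then have "\<And>x. x \<in> S \<Longrightarrow> a * x + b * x\<^sup>2 \<in> D" using assms by auto
  then show "(\<Prod>x\<in>S. \<psi> (a * x + b * x\<^sup>2)) = \<psi> (a * (\<Sum>x\<in>S. x) + b * (\<Sum>x\<in>S. x\<^sup>2))"
    by (simp add: \<psi>_sum[symmetric] sum.distrib sum_distrib_left)
qed

text \<open>After exchanging the sums, orthogonality in a detects the first power sum and
  orthogonality in b the second, each with a factor n.\<close>

lemma power_sum_count_fourier:
  assumes "s \<in> D" "t \<in> D"
  shows "(of_nat (card D))\<^sup>2 * of_nat (power_sum_count D m s t) =
    (\<Sum>(a, b)\<in>D \<times> D. \<psi> (- (a * s + b * t)) * elem_sym (\<lambda>x. \<psi> (a * x + b * x\<^sup>2)) D m)"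
proof -
  let ?T = "{S. S \<subseteq> D \<and> card S = m}"
  let ?\<sigma> = "\<lambda>S. \<Sum>x\<in>S. x" and ?\<tau> = "\<lambda>S. \<Sum>x\<in>S. x\<^sup>2"
  have in_D: "?\<sigma> S \<in> D" "?\<tau> S \<in> D" if "S \<in> ?T" for S
    using that by (auto intro!: sum_in)
  have "(\<Sum>(a, b)\<in>D \<times> D. \<psi> (- (a * s + b * t)) * elem_sym (\<lambda>x. \<psi> (a * x + b * x\<^sup>2)) D m)
      = (\<Sum>(a, b)\<in>D \<times> D. \<Sum>S\<in>?T. \<psi> (- (a * s + b * t)) * \<psi> (a * ?\<sigma> S + b * ?\<tau> S))"
    by (intro sum.cong refl) (auto simp: elem_sym_character sum_distrib_left)
  also have "\<dots> = (\<Sum>(a, b)\<in>D \<times> D. \<Sum>S\<in>?T. \<psi> ((?\<sigma> S - s) * a) * \<psi> ((?\<tau> S - t) * b))"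
    using in_D assms
    by (intro sum.cong refl) (auto simp: \<psi>_add[symmetric] algebra_simps intro!: sum.cong)
  also have "\<dots> = (\<Sum>S\<in>?T. \<Sum>(a, b)\<in>D \<times> D. \<psi> ((?\<sigma> S - s) * a) * \<psi> ((?\<tau> S - t) * b))"
    unfolding case_prod_unfold by (rule sum.swap)
  also have "\<dots> = (\<Sum>S\<in>?T. (\<Sum>a\<in>D. \<psi> ((?\<sigma> S - s) * a)) * (\<Sum>b\<in>D. \<psi> ((?\<tau> S - t) * b)))"
    by (simp add: sum_product sum.cartesian_product)
  also have "\<dots> = (\<Sum>S\<in>?T. if ?\<sigma> S = s \<and> ?\<tau> S = t then (of_nat (card D))\<^sup>2 else 0)"
    using in_D assms by (intro sum.cong refl) (simp add: sum_\<psi> power2_eq_square)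
  also have "\<dots> = (\<Sum>S | S \<in> ?T \<and> (?\<sigma> S = s \<and> ?\<tau> S = t). (of_nat (card D))\<^sup>2)"
    by (rule sum.inter_filter[symmetric]) simp
  also have "\<dots> = (of_nat (card D))\<^sup>2 * of_nat (power_sum_count D m s t)"
    by (simp add: power_sum_count_def conj_assoc mult.commute)
  finally show ?thesis ..
qed

text \<open>Common estimate for the point count and the parabola count, which differ only in the
  kernel \<open>K\<close>. The pair (0, 0) yields the main term; the fewer than n^2 other pairs each
  contribute at most \<open>B\<close> times the bound on the symmetric functions.\<close>

lemma fourier_error_le:
  fixes K :: "'a \<Rightarrow> 'a \<Rightarrow> complex" and W :: real
  assumes W: "of_real ((real (card D))\<^sup>2 * W) =
      (\<Sum>(a, b)\<in>D \<times> D. K a b * elem_sym (\<lambda>x. \<psi> (a * x + b * x\<^sup>2)) D m)"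
    and K0: "K 0 0 = of_real \<kappa>"
    and K: "\<And>a b. a \<in> D \<Longrightarrow> b \<in> D \<Longrightarrow> (a, b) \<noteq> (0, 0) \<Longrightarrow> norm (K a b) \<le> B"
    and B: "B \<ge> 0"
  shows "\<bar>W - \<kappa> * real (card D choose m) / (real (card D))\<^sup>2\<bar> \<le> B * A_sum p m (card D) (1 / sqrt (card D))"
proof -
  let ?n = "real (card D)" and ?A = "A_sum p m (card D) (1 / sqrt (card D))"
  let ?e = "\<lambda>a b. elem_sym (\<lambda>x. \<psi> (a * x + b * x\<^sup>2)) D m"
  have n0: "?n \<noteq> 0" using card_D_pos by (metis of_nat_eq_0_iff less_irrefl)
  \<comment> \<open>The bound is nonnegative because it dominates a norm; (0, 1) is a convenient
    nonzero pair.\<close>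
  have "norm (?e 0 1) \<le> ?A" by (rule norm_elem_sym_character_le) auto
  then have A0: "?A \<ge> 0" by (rule order.trans[OF norm_ge_zero])
  have e0: "?e 0 0 = of_nat (card D choose m)"
    by (simp add: elem_sym_def n_subsets)
  have "of_real (?n\<^sup>2 * W) = K 0 0 * ?e 0 0 + (\<Sum>(a, b)\<in>D \<times> D - {(0, 0)}. K a b * ?e a b)"
    unfolding W by (subst sum.remove[of _ "(0, 0)"]) auto
  then have "of_real (?n\<^sup>2 * W - \<kappa> * real (card D choose m)) = (\<Sum>(a, b)\<in>D \<times> D - {(0, 0)}. K a b * ?e a b)"
    by (simp only: K0 e0 of_real_diff of_real_mult of_real_of_nat_eq add_diff_cancel_left')
  then have "\<bar>?n\<^sup>2 * W - \<kappa> * real (card D choose m)\<bar> = norm (\<Sum>(a, b)\<in>D \<times> D - {(0, 0)}. K a b * ?e a b)"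
    by (metis norm_of_real real_norm_def)
  also have "\<dots> \<le> (\<Sum>(a, b)\<in>D \<times> D - {(0, 0)}. B * ?A)"
    using K B norm_elem_sym_character_le
    by (intro sum_norm_le) (auto simp: norm_mult intro!: mult_mono)
  also have "\<dots> = real (card (D \<times> D - {(0, 0)})) * (B * ?A)" by (simp add: case_prod_unfold)
  also have "\<dots> \<le> ?n\<^sup>2 * (B * ?A)"
  proof (intro mult_right_mono)
    have "card (D \<times> D - {(0, 0)}) \<le> card (D \<times> D)" by (rule card_mono) auto
    then show "real (card (D \<times> D - {(0, 0)})) \<le> ?n\<^sup>2"
      by (simp add: card_cartesian_product power2_eq_square flip: of_nat_mult)
  qed (use A0 B in simp)
  finally have "\<bar>?n\<^sup>2 * W - \<kappa> * real (card D choose m)\<bar> \<le> ?n\<^sup>2 * (B * ?A)" .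
  moreover have "?n\<^sup>2 * W - \<kappa> * real (card D choose m) = ?n\<^sup>2 * (W - \<kappa> * real (card D choose m) / ?n\<^sup>2)"
    using n0 by (simp add: field_simps)
  ultimately have "?n\<^sup>2 * \<bar>W - \<kappa> * real (card D choose m) / ?n\<^sup>2\<bar> \<le> ?n\<^sup>2 * (B * ?A)"
    by (simp only: abs_mult abs_power2)
  then show ?thesis using n0 by (metis mult_le_cancel_left_pos zero_less_power2)
qed

lemma power_sum_count_error:
  assumes "s \<in> D" "t \<in> D"
  shows "\<bar>real (power_sum_count D m s t) - real (card D choose m) / (real (card D))\<^sup>2\<bar>
    \<le> A_sum p m (card D) (1 / sqrt (card D))"
proof -
  have "\<bar>real (power_sum_count D m s t) - 1 * real (card D choose m) / (real (card D))\<^sup>2\<bar>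
      \<le> 1 * A_sum p m (card D) (1 / sqrt (card D))"
    using assms power_sum_count_fourier[OF assms, of m]
    by (intro fourier_error_le[where K = "\<lambda>a b. \<psi> (- (a * s + b * t))"]) (auto simp: norm_\<psi>)
  then show ?thesis by simp
qed

text \<open>Summing over the parabola turns the kernel into a Gauss sum in s up to a factor of
  modulus 1, hence of modulus at most sqrt n. At (0, 0) the kernel is n, so one factor n cancels in
  the main term.\<close>

lemma parabola_count_error:
  assumes "s\<^sub>0 \<in> D" "c \<in> D"
  shows "\<bar>real (\<Sum>s\<in>D. power_sum_count D m s (c - (s - s\<^sub>0)\<^sup>2)) - real (card D choose m) / real (card D)\<bar>
    \<le> sqrt (card D) * A_sum p m (card D) (1 / sqrt (card D))"
proof -
  let ?K = "\<lambda>a b. \<Sum>s\<in>D. \<psi> (- (a * s + b * (c - (s - s\<^sub>0)\<^sup>2)))"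
  let ?n = "real (card D)"
  have K: "norm (?K a b) \<le> sqrt ?n" if "a \<in> D" "b \<in> D" "(a, b) \<noteq> (0, 0)" for a b
  proof -
    \<comment> \<open>These are the linear and constant coefficients of the exponent as a polynomial
      in s; its quadratic coefficient is b.\<close>
    let ?a = "- (a + 2 * b * s\<^sub>0)" and ?c = "b * s\<^sub>0\<^sup>2 - b * c"
    have K_eq: "?K a b = (\<Sum>s\<in>D. \<psi> ?c * \<psi> (?a * s + b * s\<^sup>2))"
    proof (intro sum.cong refl)
      fix s assume "s \<in> D"
      then have "\<psi> ?c * \<psi> (?a * s + b * s\<^sup>2) = \<psi> (?c + (?a * s + b * s\<^sup>2))"
        using that assms by (intro \<psi>_add[symmetric]) auto
      also have "?c + (?a * s + b * s\<^sup>2) = - (a * s + b * (c - (s - s\<^sub>0)\<^sup>2))"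
        by (simp add: power2_eq_square algebra_simps)
      finally show "\<psi> (- (a * s + b * (c - (s - s\<^sub>0)\<^sup>2))) = \<psi> ?c * \<psi> (?a * s + b * s\<^sup>2)" ..
    qed
    have "norm (?K a b) = norm (\<Sum>s\<in>D. \<psi> (?a * s + b * s\<^sup>2))"
      unfolding K_eq sum_distrib_left[symmetric] norm_mult using norm_\<psi>[of ?c] that(2) assms by simp
    also have "\<dots> \<le> sqrt ?n"
    proof (rule norm_gauss_sum_le)
      show "(?a, b) \<noteq> (0, 0)"
      proof
        assume *: "(?a, b) = (0, 0)"
        then have "b = 0" by (rule Pair_inject)
        moreover have "?a = 0" using * by (rule Pair_inject)
        ultimately show False using that(3) by simp
      qed
    qed (use that assms in simp_all)
    finally show ?thesis .
  qed
  have "complex_of_real (?n\<^sup>2 * real (\<Sum>s\<in>D. power_sum_count D m s (c - (s - s\<^sub>0)\<^sup>2)))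
      = (\<Sum>s\<in>D. (of_nat (card D))\<^sup>2 * of_nat (power_sum_count D m s (c - (s - s\<^sub>0)\<^sup>2)))"
    by (simp add: sum_distrib_left)
  also have "\<dots> = (\<Sum>s\<in>D. \<Sum>(a, b)\<in>D \<times> D. \<psi> (- (a * s + b * (c - (s - s\<^sub>0)\<^sup>2)))
      * elem_sym (\<lambda>x. \<psi> (a * x + b * x\<^sup>2)) D m)"
    using assms by (intro sum.cong refl power_sum_count_fourier) simp_all
  also have "\<dots> = (\<Sum>(a, b)\<in>D \<times> D. ?K a b * elem_sym (\<lambda>x. \<psi> (a * x + b * x\<^sup>2)) D m)"
    unfolding case_prod_unfold by (subst sum.swap) (simp add: sum_distrib_right)
  finally have W: "complex_of_real (?n\<^sup>2 * real (\<Sum>s\<in>D. power_sum_count D m s (c - (s - s\<^sub>0)\<^sup>2)))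
      = (\<Sum>(a, b)\<in>D \<times> D. ?K a b * elem_sym (\<lambda>x. \<psi> (a * x + b * x\<^sup>2)) D m)" .
  have "\<bar>real (\<Sum>s\<in>D. power_sum_count D m s (c - (s - s\<^sub>0)\<^sup>2)) - ?n * real (card D choose m) / ?n\<^sup>2\<bar>
      \<le> sqrt ?n * A_sum p m (card D) (1 / sqrt (card D))"
    by (rule fourier_error_le[OF W _ K]) simp_all
  moreover have "?n * real (card D choose m) / ?n\<^sup>2 = real (card D choose m) / ?n"
    by (simp add: power2_eq_square)
  ultimately show ?thesis by (simp only:)
qed

end

section \<open>Sieving polynomials by their roots\<close>

text \<open>Since (t choose j)(j choose r) = (t choose r)(t - r choose j - r), this is an
  alternating row sum of binomials, which vanishes unless t = r. The exponent j + r has the parity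
  of j - r without truncated subtraction.\<close>

lemma alternating_binomial_sum:
  assumes "t \<le> M"
  shows "(\<Sum>j\<le>M. (-1) ^ (j + r) * real (j choose r) * real (t choose j)) = (if t = r then 1 else 0)"
proof (cases "r \<le> t")
  case False
  then have "(j choose r = 0) \<or> (t choose j = 0)" for j
    by (cases "j < r") (simp_all add: binomial_eq_0)
  then have "(\<Sum>j\<le>M. (-1) ^ (j + r) * real (j choose r) * real (t choose j)) = (\<Sum>j\<le>M. 0)"
    by (intro sum.cong refl) auto
  then show ?thesis using False by auto
next
  case True
  have "(\<Sum>j\<le>M. (-1) ^ (j + r) * real (j choose r) * real (t choose j))
      = (\<Sum>j=r..t. (-1) ^ (j + r) * real (j choose r) * real (t choose j))"
    using assms by (intro sum.mono_neutral_right) (auto simp: not_le)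
  also have "\<dots> = (\<Sum>i\<le>t - r. (-1) ^ i * real ((t - r) choose i) * real (t choose r))"
  proof (rule sum.reindex_bij_witness[of _ "\<lambda>i. i + r" "\<lambda>j. j - r"])
    fix j assume j: "j \<in> {r..t}"
    have "(t choose j) * (j choose r) = (t choose r) * ((t - r) choose (j - r))"
      using j by (intro choose_mult) auto
    then have "real (j choose r) * real (t choose j) = real ((t - r) choose (j - r)) * real (t choose r)"
      by (metis mult.commute of_nat_mult)
    moreover have "(-1::real) ^ (j + r) = (-1) ^ (j - r)"
      using j by (auto simp: minus_one_power_iff)
    ultimately show "(-1) ^ (j - r) * real ((t - r) choose (j - r)) * real (t choose r)
        = (-1) ^ (j + r) * real (j choose r) * real (t choose j)"
      by (simp add: mult.assoc)
  qed (use True in auto)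
  also have "\<dots> = (\<Sum>i\<le>t - r. (-1) ^ i * real ((t - r) choose i)) * real (t choose r)"
    by (simp add: sum_distrib_right)
  also have "\<dots> = (if t = r then 1 else 0)"
    using True choose_alternating_sum[of "t - r", where ?'a = real] by auto
  finally show ?thesis .
qed

text \<open>Double counting turns the inner sum into the sum over x of (card (R x) choose j);
  binomial inversion then singles out the x with exactly r elements in \<open>R x\<close>.\<close>

lemma card_filter_eq_sieve:
  fixes R :: "'b \<Rightarrow> 'a set"
  assumes "finite X" "finite D" "\<And>x. x \<in> X \<Longrightarrow> R x \<subseteq> D" "\<And>x. x \<in> X \<Longrightarrow> card (R x) \<le> M"
  shows "real (card {x \<in> X. card (R x) = r}) =
    (\<Sum>j\<le>M. (-1) ^ (j + r) * real (j choose r) *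
      real (\<Sum>S | S \<subseteq> D \<and> card S = j. card {x \<in> X. S \<subseteq> R x}))"
proof -
  have W: "(\<Sum>S | S \<subseteq> D \<and> card S = j. card {x \<in> X. S \<subseteq> R x}) = (\<Sum>x\<in>X. card (R x) choose j)" for j
  proof -
    have "(\<Sum>S | S \<subseteq> D \<and> card S = j. card {x \<in> X. S \<subseteq> R x})
        = (\<Sum>S | S \<subseteq> D \<and> card S = j. \<Sum>x\<in>X. if S \<subseteq> R x then 1 else 0)"
      using assms(1) by (simp add: sum.inter_filter[symmetric])
    also have "\<dots> = (\<Sum>x\<in>X. \<Sum>S | S \<subseteq> D \<and> card S = j. if S \<subseteq> R x then 1 else 0)"
      by (rule sum.swap)
    also have "\<dots> = (\<Sum>x\<in>X. card (R x) choose j)"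
    proof (intro sum.cong refl)
      fix x assume x: "x \<in> X"
      have "(\<Sum>S | S \<subseteq> D \<and> card S = j. if S \<subseteq> R x then 1 else 0)
          = card {S \<in> {S. S \<subseteq> D \<and> card S = j}. S \<subseteq> R x}"
        using assms(2) by (simp add: sum.inter_filter[symmetric] del: mem_Collect_eq)
      also have "{S \<in> {S. S \<subseteq> D \<and> card S = j}. S \<subseteq> R x} = {S. S \<subseteq> R x \<and> card S = j}"
        using assms(3)[OF x] by auto
      also have "card \<dots> = card (R x) choose j"
        using assms(2) assms(3)[OF x] by (intro n_subsets) (rule finite_subset)
      finally show "(\<Sum>S | S \<subseteq> D \<and> card S = j. if S \<subseteq> R x then 1 else 0) = card (R x) choose j" .
    qed
    finally show ?thesis .
  qed
  have "real (card {x \<in> X. card (R x) = r}) = (\<Sum>x\<in>X. if card (R x) = r then 1 else 0)"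
    using assms(1) by (simp add: sum.inter_filter[symmetric])
  also have "\<dots> = (\<Sum>x\<in>X. \<Sum>j\<le>M. (-1) ^ (j + r) * real (j choose r) * real (card (R x) choose j))"
    using assms(4) by (intro sum.cong refl) (simp only: alternating_binomial_sum)
  also have "\<dots> = (\<Sum>j\<le>M. \<Sum>x\<in>X. (-1) ^ (j + r) * real (j choose r) * real (card (R x) choose j))"
    by (rule sum.swap)
  also have "\<dots> = (\<Sum>j\<le>M. (-1) ^ (j + r) * real (j choose r) * real (\<Sum>x\<in>X. card (R x) choose j))"
    by (simp add: sum_distrib_left)
  finally show ?thesis unfolding W .
qed

section \<open>Polynomials of bounded degree and products of linear factors\<close>

definition polys_below :: "nat \<Rightarrow> 'a::zero poly set" where
  "polys_below d = {h. \<forall>i\<ge>d. coeff h i = 0}"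

text \<open>The zero polynomial is listed separately because its degree is 0 by convention, which is
  not below d = 0.\<close>

lemma polys_below_iff: "h \<in> polys_below d \<longleftrightarrow> h = 0 \<or> degree h < d"
  unfolding polys_below_def
  by (auto simp: coeff_eq_0) (metis leading_coeff_0_iff not_le)

lemma polys_below_0 [simp]: "polys_below 0 = {0}"
  by (auto simp: polys_below_iff)

lemma polys_below_Suc: "polys_below (Suc d) = (\<lambda>(a, t). pCons a t) ` (UNIV \<times> polys_below d)"
proof (rule set_eqI)
  fix h :: "'a poly"
  obtain a t where h: "h = pCons a t" by (rule pCons_cases)
  have "h \<in> polys_below (Suc d) \<longleftrightarrow> t \<in> polys_below d"
    unfolding polys_below_def h
    by (auto simp: coeff_pCons split: nat.splits)
  then show "h \<in> polys_below (Suc d) \<longleftrightarrow> h \<in> (\<lambda>(a, t). pCons a t) ` (UNIV \<times> polys_below d)"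
    by (auto simp: h)
qed

lemma finite_polys_below [simp]: "finite (polys_below d :: 'a::{zero,finite} poly set)"
  by (induction d) (simp_all add: polys_below_Suc)

lemma card_polys_below: "card (polys_below d :: 'a::{zero,finite} poly set) = CARD('a) ^ d"
proof (induction d)
  case (Suc d)
  have "inj_on (\<lambda>(a, t). pCons a t) (UNIV \<times> polys_below d :: ('a \<times> 'a poly) set)"
    by (auto simp: inj_on_def)
  then show ?case by (simp add: polys_below_Suc card_image card_cartesian_product Suc)
qed simp

lemma polys_below_add: "g \<in> polys_below d \<Longrightarrow> h \<in> polys_below d \<Longrightarrow> g + h \<in> polys_below d"
  and polys_below_diff: "g' \<in> polys_below d \<Longrightarrow> h' \<in> polys_below d \<Longrightarrow> g' - h' \<in> polys_below d"
  for g h :: "'a::comm_monoid_add poly" and g' h' :: "'b::ab_group_add poly"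
  by (simp_all add: polys_below_def)

definition linear_prod :: "'a::comm_ring_1 set \<Rightarrow> 'a poly" where
  "linear_prod S = (\<Prod>\<alpha>\<in>S. [:\<alpha>, 1:])"

lemma monic_linear_prod: "lead_coeff (linear_prod S) = 1"
  for S :: "'a::field set"
  unfolding linear_prod_def by (simp add: lead_coeff_prod del: lead_coeff_pCons)

lemma linear_prod_neq_0: "linear_prod S \<noteq> 0"
  for S :: "'a::field set"
  using monic_linear_prod[of S] by auto

lemma degree_linear_prod: "degree (linear_prod S) = card S"
  for S :: "'a::field set"
  unfolding linear_prod_def by (subst degree_prod_eq_sum_degree) auto

lemma linear_dvd_iff: "[:\<alpha>, 1:] dvd g \<longleftrightarrow> poly g (- \<alpha>) = 0"
  for g :: "'a::field poly"
  using poly_eq_0_iff_dvd[of g "- \<alpha>"] by simp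

text \<open>Distinct linear factors are coprime: -\<alpha> is not a root of the product over the
  remaining elements, so it must be a root of the cofactor.\<close>

lemma linear_prod_dvd_iff:
  fixes g :: "'a::field poly"
  assumes "finite S"
  shows "linear_prod S dvd g \<longleftrightarrow> (\<forall>\<alpha>\<in>S. [:\<alpha>, 1:] dvd g)"
  using assms
proof (induction S arbitrary: g)
  case (insert \<alpha> S)
  have eq: "linear_prod (insert \<alpha> S) = [:\<alpha>, 1:] * linear_prod S"
    using insert.hyps by (simp add: linear_prod_def)
  have neq: "poly (linear_prod S) (- \<alpha>) \<noteq> 0"
    using insert.hyps by (auto simp: linear_prod_def poly_prod)
  show ?case
  proof
    assume "linear_prod (insert \<alpha> S) dvd g"
    then show "\<forall>\<beta>\<in>insert \<alpha> S. [:\<beta>, 1:] dvd g"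
      using insert.IH[of g] unfolding eq by (metis dvd_mult_left dvd_mult_right insert_iff)
  next
    assume *: "\<forall>\<beta>\<in>insert \<alpha> S. [:\<beta>, 1:] dvd g"
    then have "linear_prod S dvd g" using insert.IH by simp
    then obtain t where t: "g = linear_prod S * t" by (elim dvdE)
    have "poly g (- \<alpha>) = 0" using * by (simp add: linear_dvd_iff)
    then have "[:\<alpha>, 1:] dvd t" using neq by (simp add: t linear_dvd_iff)
    then show "linear_prod (insert \<alpha> S) dvd g"
      unfolding eq t by (metis mult.commute dvd_refl mult_dvd_mono)
  qed
qed (simp add: linear_prod_def)

text \<open>Multiplying by \<open>x\<^sup>2\<close> keeps the three top coefficients at nonnegative indices even when
  \<open>card S < 2\<close>.\<close>

lemma linear_prod_top_coeffs:
  fixes S :: "'a::field set"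
  assumes "finite S"
  defines "Q \<equiv> pCons 0 (pCons 0 (linear_prod S))"
  shows "coeff Q (card S + 2) = 1" "coeff Q (card S + 1) = (\<Sum>x\<in>S. x)"
    "2 * coeff Q (card S) = (\<Sum>x\<in>S. x)\<^sup>2 - (\<Sum>x\<in>S. x\<^sup>2)"
proof -
  have "coeff (pCons 0 (pCons 0 (linear_prod S))) (card S + 2) = 1 \<and>
      coeff (pCons 0 (pCons 0 (linear_prod S))) (card S + 1) = (\<Sum>x\<in>S. x) \<and>
      2 * coeff (pCons 0 (pCons 0 (linear_prod S))) (card S) = (\<Sum>x\<in>S. x)\<^sup>2 - (\<Sum>x\<in>S. x\<^sup>2)"
    using assms(1)
  proof (induction S)
    case empty
    then show ?case by (simp add: linear_prod_def numeral_2_eq_2)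
  next
    case (insert \<alpha> S)
    let ?Q = "pCons 0 (pCons 0 (linear_prod S))"
    have "pCons 0 (pCons 0 (linear_prod (insert \<alpha> S))) = smult \<alpha> ?Q + pCons 0 ?Q"
      using insert.hyps by (simp add: linear_prod_def)
    then have step: "coeff (pCons 0 (pCons 0 (linear_prod (insert \<alpha> S)))) (Suc i)
        = \<alpha> * coeff ?Q (Suc i) + coeff ?Q i" for i
      by (simp only: coeff_add coeff_smult coeff_pCons_Suc)
    \<comment> \<open>The new leading coefficient sits at index card S + 3, one above the degree of
      \<open>?Q\<close>, so only the shifted copy of \<open>?Q\<close> contributes to it.\<close>
    have "card S + 3 > degree ?Q"
      by (simp add: degree_linear_prod linear_prod_neq_0)
    then have "coeff ?Q (card S + 3) = 0" by (rule coeff_eq_0)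
    moreover have "2 * coeff (pCons 0 (pCons 0 (linear_prod (insert \<alpha> S)))) (Suc (card S))
        = 2 * \<alpha> * coeff ?Q (card S + 1) + 2 * coeff ?Q (card S)"
      unfolding step by (simp add: algebra_simps)
    ultimately show ?case
      using insert step[of "card S + 2"] step[of "card S + 1"]
      by (simp add: numeral_3_eq_3 numeral_2_eq_2 power2_eq_square algebra_simps)
  qed
  then show "coeff Q (card S + 2) = 1" "coeff Q (card S + 1) = (\<Sum>x\<in>S. x)"
    "2 * coeff Q (card S) = (\<Sum>x\<in>S. x)\<^sup>2 - (\<Sum>x\<in>S. x\<^sup>2)"
    unfolding Q_def by auto
qed

text \<open>The admissible h are the P t - (f mod P) with t of degree below k - degree P or zero;
  subtracting the remainder stays below degree k because degree P \<le> k.\<close>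

lemma card_multiples_below:
  fixes f P :: "'a::{field,finite} poly"
  assumes "P \<noteq> 0" "degree P \<le> k"
  shows "card {h \<in> polys_below k. P dvd f + h} = CARD('a) ^ (k - degree P)"
proof -
  have mult_iff: "P * t \<in> polys_below k \<longleftrightarrow> t \<in> polys_below (k - degree P)" for t
    using assms by (cases "t = 0") (auto simp: polys_below_iff degree_mult_eq)
  have mod_in: "f mod P \<in> polys_below k"
    using degree_mod_less[OF assms(1), of f] assms(2) by (auto simp: polys_below_iff)
  have "{h \<in> polys_below k. P dvd f + h} = (\<lambda>t. P * t - f mod P) ` polys_below (k - degree P)"
  proof (intro equalityI subsetI)
    fix h assume "h \<in> {h \<in> polys_below k. P dvd f + h}"
    then have h: "h \<in> polys_below k" "P dvd f + h" by auto
    then obtain u where u: "f + h = P * u" by (elim dvdE)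
    define t where "t = u - f div P"
    have "P * t = (f + h) - (f - f mod P)"
      by (simp add: t_def right_diff_distrib u minus_mod_eq_mult_div)
    then have t: "P * t = h + f mod P" by simp
    then have "t \<in> polys_below (k - degree P)"
      using polys_below_add[OF h(1) mod_in] by (simp flip: mult_iff)
    then show "h \<in> (\<lambda>t. P * t - f mod P) ` polys_below (k - degree P)"
      using t by (intro image_eqI[of _ _ t]) auto
  next
    fix h assume "h \<in> (\<lambda>t. P * t - f mod P) ` polys_below (k - degree P)"
    then obtain t where t: "t \<in> polys_below (k - degree P)" "h = P * t - f mod P" by blast
    have "f + h = P * t + (f - f mod P)" by (simp add: t)
    then have "P dvd f + h" by (simp add: minus_mod_eq_mult_div)
    moreover have "h \<in> polys_below k"
      unfolding t(2) using t(1) mod_in by (intro polys_below_diff) (simp_all add: mult_iff)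
    ultimately show "h \<in> {h \<in> polys_below k. P dvd f + h}" by simp
  qed
  moreover have "inj_on (\<lambda>t. P * t - f mod P) (polys_below (k - degree P))"
    using assms(1) by (auto simp: inj_on_def)
  ultimately show ?thesis by (simp add: card_image card_polys_below)
qed

section \<open>Multiples of a linear product among the polynomials with prescribed top
  coefficients\<close>

locale prescribed_top =
  fixes k :: nat and \<gamma>\<^sub>1 \<gamma>\<^sub>2 :: "'a::{field,finite}" and f :: "'a poly"
  assumes f_eq: "f = monom 1 (k + 2) + monom \<gamma>\<^sub>1 (k + 1) + monom \<gamma>\<^sub>2 k"
begin

lemma diff_f_in_iff:
  "g - f \<in> polys_below k \<longleftrightarrow>
    coeff g k = \<gamma>\<^sub>2 \<and> coeff g (k + 1) = \<gamma>\<^sub>1 \<and> coeff g (k + 2) = 1 \<and> (\<forall>i>k + 2. coeff g i = 0)"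
proof -
  have "(\<forall>i\<ge>k. P i) \<longleftrightarrow> P k \<and> P (k + 1) \<and> P (k + 2) \<and> (\<forall>i>k + 2. P i)" for P :: "nat \<Rightarrow> bool"
  proof -
    have "i = k \<or> i = k + 1 \<or> i = k + 2 \<or> i > k + 2" if "i \<ge> k" for i using that by linarith
    then show ?thesis by auto
  qed
  from this[of "\<lambda>i. coeff (g - f) i = 0"] show ?thesis
    by (simp add: polys_below_def f_eq coeff_monom)
qed

lemma degree_f_add:
  assumes "h \<in> polys_below k"
  shows "degree (f + h) = k + 2" "lead_coeff (f + h) = 1"
proof -
  have "(f + h) - f \<in> polys_below k" using assms by simp
  then have *: "coeff (f + h) (k + 2) = 1" "\<forall>i>k + 2. coeff (f + h) i = 0"
    unfolding diff_f_in_iff by auto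
  then show "degree (f + h) = k + 2"
    by (intro antisym degree_le le_degree) auto
  then show "lead_coeff (f + h) = 1" using * by simp
qed

text \<open>Pins down the cofactor when \<open>S\<close> is large: it is 1 for card S = k + 2 and
  monic linear for card S = k + 1.\<close>

lemma f_add_eq_monic_mult:
  assumes "h \<in> polys_below k" "linear_prod S dvd f + h"
  obtains u where "f + h = linear_prod S * u" "lead_coeff u = 1" "degree u + card S = k + 2"
proof -
  obtain u where u: "f + h = linear_prod S * u" using assms(2) by (elim dvdE)
  have "lead_coeff (f + h) = lead_coeff u"
    unfolding u lead_coeff_mult by (simp add: monic_linear_prod)
  then have lc: "lead_coeff u = 1" using degree_f_add[OF assms(1)] by simp
  then have "degree (f + h) = card S + degree u"
    unfolding u by (subst degree_mult_eq) (auto simp: linear_prod_neq_0 degree_linear_prod)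
  then have "degree u + card S = k + 2" using degree_f_add[OF assms(1)] by simp
  with u lc show thesis by (rule that)
qed

text \<open>The only candidate for f + h is the product itself. Its two coefficients must match, and
  twice the second is the square of the first minus the sum of squares, so invertibility of 2 gives
  the condition on power sums.\<close>

lemma card_multiples_full:
  assumes "finite S" "card S = k + 2" "(2::'a) \<noteq> 0"
  shows "card {h \<in> polys_below k. linear_prod S dvd f + h} =
    (if (\<Sum>x\<in>S. x) = \<gamma>\<^sub>1 \<and> (\<Sum>x\<in>S. x\<^sup>2) = \<gamma>\<^sub>1\<^sup>2 - 2 * \<gamma>\<^sub>2 then 1 else 0)"
proof -
  let ?P = "linear_prod S"
  have "{h \<in> polys_below k. ?P dvd f + h} = (if ?P - f \<in> polys_below k then {?P - f} else {})"
  proof -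
    have "h = ?P - f" if h: "h \<in> polys_below k" "?P dvd f + h" for h
    proof -
      obtain u where "f + h = ?P * u" "lead_coeff u = 1" "degree u + card S = k + 2"
        using f_add_eq_monic_mult[OF h] by blast
      moreover from this have "u = 1" using assms(2) by (auto elim!: degree_eq_zeroE)
      ultimately show ?thesis by (simp add: eq_diff_eq add.commute)
    qed
    then have sub: "{h \<in> polys_below k. ?P dvd f + h} \<subseteq> {?P - f}" by blast
    have "?P dvd f + (?P - f)" by simp
    with sub show ?thesis by (cases "?P - f \<in> polys_below k") (simp_all only: if_True if_False, blast+)
  qed
  moreover have "?P - f \<in> polys_below k \<longleftrightarrow>
      (\<Sum>x\<in>S. x) = \<gamma>\<^sub>1 \<and> (\<Sum>x\<in>S. x\<^sup>2) = \<gamma>\<^sub>1\<^sup>2 - 2 * \<gamma>\<^sub>2"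
  proof -
    have c: "coeff ?P (k + 2) = 1" "coeff ?P (k + 1) = (\<Sum>x\<in>S. x)"
      "2 * coeff ?P k = (\<Sum>x\<in>S. x)\<^sup>2 - (\<Sum>x\<in>S. x\<^sup>2)"
      using linear_prod_top_coeffs[OF assms(1)] assms(2) by simp_all
    have "\<forall>i>k + 2. coeff ?P i = 0" using assms(2) by (simp add: coeff_eq_0 degree_linear_prod)
    moreover have "coeff ?P k = \<gamma>\<^sub>2 \<longleftrightarrow> 2 * coeff ?P k = 2 * \<gamma>\<^sub>2" using assms(3) by simp
    ultimately show ?thesis unfolding diff_f_in_iff c by (auto simp: algebra_simps)
  qed
  ultimately show ?thesis by simp
qed

text \<open>The cofactor is x + \<beta>, and the coefficient at k + 1 forces \<beta> to be
  \<open>\<gamma>\<^sub>1\<close> minus the sum of \<open>S\<close>. The coefficient at k then gives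
  one equation; doubling it and completing the square yields the parabola.\<close>

lemma card_multiples_almost_full:
  assumes "finite S" "card S = k + 1" "(2::'a) \<noteq> 0"
  shows "card {h \<in> polys_below k. linear_prod S dvd f + h} =
    (if (\<Sum>x\<in>S. x\<^sup>2) = (\<gamma>\<^sub>1\<^sup>2 - 2 * \<gamma>\<^sub>2) - ((\<Sum>x\<in>S. x) - \<gamma>\<^sub>1)\<^sup>2 then 1 else 0)"
proof -
  let ?P = "linear_prod S" and ?s = "\<Sum>x\<in>S. x"
  let ?g = "\<lambda>\<beta>. ?P * [:\<beta>, 1:]"
  \<comment> \<open>\<open>coeff (pCons 0 ?P) k\<close> is the coefficient of \<open>?P\<close> at k
    - 1, and is correctly 0 for k = 0.\<close>
  have c: "coeff ?P (k + 1) = 1" "coeff ?P k = ?s"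
    "2 * coeff (pCons 0 ?P) k = ?s\<^sup>2 - (\<Sum>x\<in>S. x\<^sup>2)"
    using linear_prod_top_coeffs[OF assms(1)] assms(2) by simp_all
  have P0: "coeff ?P i = 0" if "i > k + 1" for i
    using that assms(2) by (simp add: coeff_eq_0 degree_linear_prod)
  have g: "?g \<beta> = smult \<beta> ?P + pCons 0 ?P" for \<beta> by simp
  have g_iff: "?g \<beta> - f \<in> polys_below k \<longleftrightarrow>
      \<beta> * ?s + coeff (pCons 0 ?P) k = \<gamma>\<^sub>2 \<and> \<beta> = \<gamma>\<^sub>1 - ?s" for \<beta>
  proof -
    have "\<forall>i>k + 2. coeff (?g \<beta>) i = 0"
      unfolding g by (auto simp: coeff_pCons P0 split: nat.splits)
    moreover have "coeff (?g \<beta>) (k + 2) = 1" "coeff (?g \<beta>) (k + 1) = \<beta> + ?s"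
      "coeff (?g \<beta>) k = \<beta> * ?s + coeff (pCons 0 ?P) k"
      unfolding g using c P0[of "k + 2"] by (simp_all add: numeral_2_eq_2)
    ultimately show ?thesis unfolding diff_f_in_iff by (auto simp: algebra_simps)
  qed
  have "{h \<in> polys_below k. ?P dvd f + h}
      = (if ?g (\<gamma>\<^sub>1 - ?s) - f \<in> polys_below k then {?g (\<gamma>\<^sub>1 - ?s) - f} else {})"
  proof -
    have "h = ?g (\<gamma>\<^sub>1 - ?s) - f" if h: "h \<in> polys_below k" "?P dvd f + h" for h
    proof -
      obtain u where u: "f + h = ?P * u" "lead_coeff u = 1" "degree u + card S = k + 2"
        using f_add_eq_monic_mult[OF h] by blast
      then have "degree u = 1" using assms(2) by simp
      then have "u = [:coeff u 0, 1:]"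
        using u(2) by (intro poly_eqI) (auto simp: coeff_pCons coeff_eq_0 split: nat.splits)
      then obtain \<beta> where "u = [:\<beta>, 1:]" by blast
      then have "h = ?g \<beta> - f" using u(1) by (simp only: eq_diff_eq add.commute)
      then show ?thesis using g_iff h(1) by metis
    qed
    then have sub: "{h \<in> polys_below k. ?P dvd f + h} \<subseteq> {?g (\<gamma>\<^sub>1 - ?s) - f}" by blast
    have "?P dvd f + (?g (\<gamma>\<^sub>1 - ?s) - f)" by (simp del: mult_pCons_right)
    with sub show ?thesis
      by (cases "?g (\<gamma>\<^sub>1 - ?s) - f \<in> polys_below k") (simp_all only: if_True if_False, blast+)
  qed
  moreover have "?g (\<gamma>\<^sub>1 - ?s) - f \<in> polys_below k \<longleftrightarrow>
      (\<Sum>x\<in>S. x\<^sup>2) = (\<gamma>\<^sub>1\<^sup>2 - 2 * \<gamma>\<^sub>2) - (?s - \<gamma>\<^sub>1)\<^sup>2"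
  proof -
    have "?g (\<gamma>\<^sub>1 - ?s) - f \<in> polys_below k \<longleftrightarrow>
        2 * ((\<gamma>\<^sub>1 - ?s) * ?s) + 2 * coeff (pCons 0 ?P) k = 2 * \<gamma>\<^sub>2"
      unfolding g_iff distrib_left[symmetric] mult_cancel_left using assms(3) by simp
    also have "\<dots> \<longleftrightarrow> (\<Sum>x\<in>S. x\<^sup>2) = (\<gamma>\<^sub>1\<^sup>2 - 2 * \<gamma>\<^sub>2) - (?s - \<gamma>\<^sub>1)\<^sup>2"
      unfolding c by (auto simp: power2_diff power2_eq_square algebra_simps)
    finally show ?thesis .
  qed
  ultimately show ?thesis by simp
qed

text \<open>A set \<open>S\<close> of forced roots corresponds to divisibility by its linear
  product, and the degree of f + h allows at most k + 2 of them, so the sieve stops there.\<close>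

lemma N_count_eq_sieve:
  fixes D :: "'a set"
  shows "real (N_count D k f r) = (\<Sum>j\<le>k + 2. (-1) ^ (j + r) * real (j choose r) *
    real (\<Sum>S | S \<subseteq> D \<and> card S = j. card {h \<in> polys_below k. linear_prod S dvd f + h}))"
proof -
  let ?R = "\<lambda>h. {\<alpha> \<in> D. [:\<alpha>, 1:] dvd f + h}"
  have "{g. lead_coeff g = 1 \<and> degree g = k + 2 \<and> (\<exists>h. g = f + h \<and> (\<forall>i\<ge>k. coeff h i = 0)) \<and>
      card {\<alpha> \<in> D. [:\<alpha>, 1:] dvd g} = r} = (\<lambda>h. f + h) ` {h \<in> polys_below k. card (?R h) = r}"
    using degree_f_add by (auto simp: polys_below_def)
  then have "N_count D k f r = card {h \<in> polys_below k. card (?R h) = r}"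
    unfolding N_count_def by (simp add: card_image)
  also have "real \<dots> = (\<Sum>j\<le>k + 2. (-1) ^ (j + r) * real (j choose r) *
    real (\<Sum>S | S \<subseteq> D \<and> card S = j. card {h \<in> polys_below k. S \<subseteq> ?R h}))"
  proof (rule card_filter_eq_sieve)
    fix h :: "'a poly" assume h: "h \<in> polys_below k"
    have "linear_prod (?R h) dvd f + h" by (simp add: linear_prod_dvd_iff)
    moreover have "f + h \<noteq> 0" using degree_f_add[OF h] by auto
    ultimately show "card (?R h) \<le> k + 2"
      using dvd_imp_degree_le[of "linear_prod (?R h)" "f + h"] degree_f_add[OF h]
      by (simp add: degree_linear_prod)
  qed auto
  also have "\<dots> = (\<Sum>j\<le>k + 2. (-1) ^ (j + r) * real (j choose r) *
    real (\<Sum>S | S \<subseteq> D \<and> card S = j. card {h \<in> polys_below k. linear_prod S dvd f + h}))"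
    by (intro sum.cong refl arg_cong2[where f = "(*)"] arg_cong[where f = real] arg_cong[where f = card])
      (auto simp: linear_prod_dvd_iff)
  finally show ?thesis .
qed

end

section \<open>Rewriting the sieve with generalized binomials and integer exponents\<close>

lemma choose_mult_binom:
  "real (j choose r) * real (n choose j) = binom (real n) (int r) * binom (real n - real r) (int j - int r)"
proof (cases "r \<le> j")
  case True
  show ?thesis
  proof (cases "j \<le> n")
    case le: True
    have "real n - real r = real (n - r)" "int j - int r = int (j - r)"
      using True le by (simp_all add: of_nat_diff)
    then have "binom (real n) (int r) * binom (real n - real r) (int j - int r)
        = real (n choose r) * real ((n - r) choose (j - r))"
      by (simp only: binom_def binomial_gbinomial of_nat_less_0_iff if_False nat_int)
    moreover have "(n choose j) * (j choose r) = (n choose r) * ((n - r) choose (j - r))"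
      using True le by (intro choose_mult)
    ultimately show ?thesis by (metis mult.commute of_nat_mult)
  next
    case False
    have "binom (real n) (int r) * binom (real n - real r) (int j - int r) = 0"
    \<comment> \<open>For r > n the upper argument \<open>real n - real r\<close> is negative and
      its binomial may be nonzero; the product vanishes through the factor
      \<open>binom (real n) (int r)\<close>.\<close>
    proof (cases "r \<le> n")
      case True
      have "real n - real r = real (n - r)" "int j - int r = int (j - r)"
        using True \<open>r \<le> j\<close> by (simp_all add: of_nat_diff)
      then have "binom (real n - real r) (int j - int r) = real ((n - r) choose (j - r))"
        by (simp only: binom_def binomial_gbinomial of_nat_less_0_iff if_False nat_int)
      moreover have "n - r < j - r" using False True by linarith
      ultimately show ?thesis by simp
    qed (simp add: binom_def binomial_gbinomial[symmetric])
    moreover have "n choose j = 0" using False by simp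
    ultimately show ?thesis by (metis mult_zero_right of_nat_0)
  qed
qed (simp add: binom_def)

text \<open>Shift j by r and split q^(k - j) into q^(k - r) and q^(-(j - r)); the sign turns the
  latter into a power of -q. For r > k both sides are 0.\<close>

lemma sieve_main_term:
  assumes "q > 0"
  shows "(\<Sum>j\<le>k. (-1) ^ (j + r) * real (j choose r) * (real (n choose j) * real q ^ (k - j))) =
    real q powi (int k - int r) * binom (real n) (int r) *
      (\<Sum>j\<in>{0..int k - int r}. (- real q) powi (- j) * binom (real n - real r) j)"
proof (cases "r \<le> k")
  case True
  have "(\<Sum>j\<le>k. (-1) ^ (j + r) * real (j choose r) * (real (n choose j) * real q ^ (k - j)))
      = (\<Sum>j=r..k. (-1) ^ (j + r) * (real (j choose r) * real (n choose j)) * real q ^ (k - j))"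
    by (rule sum.mono_neutral_cong_right) (auto simp: not_le)
  also have "\<dots> = (\<Sum>j=r..k. real q powi (int k - int r) * binom (real n) (int r) *
      ((- real q) powi (- (int j - int r)) * binom (real n - real r) (int j - int r)))"
  proof (intro sum.cong refl)
    fix j assume j: "j \<in> {r..k}"
    have "(- real q) powi (- (int j - int r)) = (-1) ^ (j + r) * real q powi (- (int j - int r))"
    proof -
      obtain i where i: "j = r + i" using j by (auto simp: le_iff_add)
      then have "- (int j - int r) = - int i" by simp
      moreover have "(-1::real) ^ (j + r) = (-1) ^ i" by (simp add: i minus_one_power_iff)
      moreover have "inverse ((- real q) ^ i) = (-1) ^ i * inverse (real q ^ i)"
        by (cases "even i") simp_all
      ultimately show ?thesis by (simp only: power_int_minus power_int_of_nat)
    qed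
    moreover have "real q powi (int k - int r) * real q powi (- (int j - int r)) = real q ^ (k - j)"
    proof -
      have "real q powi (int k - int r) * real q powi (- (int j - int r)) = real q powi int (k - j)"
        using assms j by (simp add: power_int_add[symmetric] of_nat_diff)
      then show ?thesis by simp
    qed
    ultimately show "(-1) ^ (j + r) * (real (j choose r) * real (n choose j)) * real q ^ (k - j)
        = real q powi (int k - int r) * binom (real n) (int r) *
          ((- real q) powi (- (int j - int r)) * binom (real n - real r) (int j - int r))"
      unfolding choose_mult_binom by (simp add: mult_ac)
  qed
  also have "\<dots> = real q powi (int k - int r) * binom (real n) (int r) *
      (\<Sum>j=r..k. (- real q) powi (- (int j - int r)) * binom (real n - real r) (int j - int r))"
    by (simp only: sum_distrib_left)
  also have "(\<Sum>j=r..k. (- real q) powi (- (int j - int r)) * binom (real n - real r) (int j - int r))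
      = (\<Sum>j\<in>{0..int k - int r}. (- real q) powi (- j) * binom (real n - real r) j)"
    by (rule sum.reindex_bij_witness[of _ "\<lambda>i. nat (i + int r)" "\<lambda>j. int j - int r"]) auto
  finally show ?thesis .
next
  case False
  then have "(\<Sum>j\<le>k. (-1) ^ (j + r) * real (j choose r) * (real (n choose j) * real q ^ (k - j))) = 0"
    by (intro sum.neutral) simp
  then show ?thesis using False by simp
qed

lemma minus_one_power_choose:
  "(-1) ^ (j + r) * real (j choose r) = (-1) powi (int j - int r) * real (j choose r)"
proof (cases "r \<le> j")
  case True
  then obtain i where "j = r + i" by (auto simp: le_iff_add)
  then show ?thesis by (simp add: minus_one_power_iff)
qed simp

context subfield_character
begin

text \<open>Slices the subsets by the value s of their first power sum, which always lies in
  \<open>D\<close>.\<close>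

lemma sum_power_sum_count_parabola:
  "(\<Sum>S | S \<subseteq> D \<and> card S = m. if (\<Sum>x\<in>S. x\<^sup>2) = c - ((\<Sum>x\<in>S. x) - s\<^sub>0)\<^sup>2 then 1 else 0)
    = (\<Sum>s\<in>D. power_sum_count D m s (c - (s - s\<^sub>0)\<^sup>2))"
proof -
  let ?T = "{S. S \<subseteq> D \<and> card S = m}"
  have "(\<Sum>s\<in>D. power_sum_count D m s (c - (s - s\<^sub>0)\<^sup>2))
      = (\<Sum>s\<in>D. \<Sum>S\<in>?T. if (\<Sum>x\<in>S. x) = s \<and> (\<Sum>x\<in>S. x\<^sup>2) = c - (s - s\<^sub>0)\<^sup>2 then 1 else 0)"
    unfolding power_sum_count_def by (simp add: sum.inter_filter[symmetric] conj_assoc)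
  also have "\<dots> = (\<Sum>S\<in>?T. \<Sum>s\<in>D. if (\<Sum>x\<in>S. x) = s \<and> (\<Sum>x\<in>S. x\<^sup>2) = c - (s - s\<^sub>0)\<^sup>2 then 1 else 0)"
    by (rule sum.swap)
  also have "\<dots> = (\<Sum>S\<in>?T. if (\<Sum>x\<in>S. x\<^sup>2) = c - ((\<Sum>x\<in>S. x) - s\<^sub>0)\<^sup>2 then 1 else 0)"
  proof (intro sum.cong refl)
    fix S assume "S \<in> ?T"
    then have "(\<Sum>x\<in>S. x) \<in> D" by (auto intro!: sum_in)
    moreover have "(\<Sum>s\<in>D. if (\<Sum>x\<in>S. x) = s \<and> (\<Sum>x\<in>S. x\<^sup>2) = c - (s - s\<^sub>0)\<^sup>2 then 1 else 0)
        = (\<Sum>s\<in>D. if (\<Sum>x\<in>S. x) = s then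
            (if (\<Sum>x\<in>S. x\<^sup>2) = c - ((\<Sum>x\<in>S. x) - s\<^sub>0)\<^sup>2 then 1 else 0) else 0 :: nat)"
      by (intro sum.cong) auto
    ultimately show "(\<Sum>s\<in>D. if (\<Sum>x\<in>S. x) = s \<and> (\<Sum>x\<in>S. x\<^sup>2) = c - (s - s\<^sub>0)\<^sup>2 then 1 else 0)
        = (if (\<Sum>x\<in>S. x\<^sup>2) = c - ((\<Sum>x\<in>S. x) - s\<^sub>0)\<^sup>2 then 1 else 0 :: nat)"
      by simp
  qed
  finally show ?thesis ..
qed

end

section \<open>Combining the sieve with the Fourier estimates\<close>

theorem theorem5:
  fixes p q n k r :: nat
    and D :: "'a::{field,finite} set"
    and \<gamma>\<^sub>1 \<gamma>\<^sub>2 :: 'a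
    and f :: "'a poly"
  assumes "prime p" and "odd p"
    and "\<exists>e>0. q = p ^ e"
    and "CARD('a) = q"
    and "is_subfield D" and "card D = n"
    and "\<gamma>\<^sub>1 \<in> D" and "\<gamma>\<^sub>2 \<in> D"
    and "f = monom 1 (k + 2) + monom \<gamma>\<^sub>1 (k + 1) + monom \<gamma>\<^sub>2 k"
  shows "\<exists>E::real.
    real (N_count D k f r) =
        real q powi (int k - int r) * binom (real n) (int r) *
          (\<Sum>j\<in>{0..int k - int r}. (- real q) powi (- j) * binom (real n - real r) j)
      + (- 1) powi (int k + 1 - int r) * (1 / real n) *
          binom (real n) (int r) * binom (real n - real r) (int k + 1 - int r)
      + (- 1) powi (int k + 2 - int r) * (1 / (real n)\<^sup>2) *
          binom (real n) (int r) * binom (real n - real r) (int k + 2 - int r)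
      + E \<and>
    \<bar>E\<bar> \<le> binom (real k + 2) (int r) * A_sum p (k + 2) (real n) (1 / sqrt (real n))
      + sqrt (real n) * binom (real k + 1) (int r) * A_sum p (k + 1) (real n) (1 / sqrt (real n))"
proof -
  obtain e where e: "e > 0" "q = p ^ e" using assms(3) by blast
  have q0: "q > 0" using e assms(1) by (simp add: prime_gt_0_nat)
  \<comment> \<open>Translation by 1 permutes the field, so q = 0 in it; as q is a power of p, also
    p = 0 there.\<close>
  have "(\<Sum>x\<in>UNIV. x + 1) = (\<Sum>x\<in>UNIV. x :: 'a)"
    by (rule sum.reindex_bij_witness[of _ "\<lambda>x. x - 1" "\<lambda>x. x + 1"]) auto
  then have "of_nat CARD('a) = (0::'a)" by (simp add: sum.distrib)
  then have "of_nat p = (0::'a)" using assms(4) e by simp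
  with assms interpret odd_subfield D p by unfold_locales
  obtain \<psi> :: "'a \<Rightarrow> complex" where \<psi>: "\<And>x y. x \<in> D \<Longrightarrow> y \<in> D \<Longrightarrow> \<psi> (x + y) = \<psi> x * \<psi> y"
    "\<And>x. x \<in> D \<Longrightarrow> norm (\<psi> x) = 1" "\<exists>x\<in>D. \<psi> x \<noteq> 1"
    using ex_nontrivial_character by blast
  interpret subfield_character D p \<psi> by unfold_locales (use \<psi> in auto)
  interpret prescribed_top k \<gamma>\<^sub>1 \<gamma>\<^sub>2 f by unfold_locales (rule assms(9))

  \<comment> \<open>Second power sum forced by first and second elementary symmetric functions
    \<open>\<gamma>\<^sub>1\<close> and \<open>\<gamma>\<^sub>2\<close>.\<close>
  define c where "c = \<gamma>\<^sub>1\<^sup>2 - 2 * \<gamma>\<^sub>2"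
  have c: "c \<in> D" using assms by (simp add: c_def)
  define W where "W j = (\<Sum>S | S \<subseteq> D \<and> card S = j. card {h \<in> polys_below k. linear_prod S dvd f + h})" for j
  define A where "A m = A_sum p m (real n) (1 / sqrt (real n))" for m
  have W_small: "W j = (n choose j) * q ^ (k - j)" if "j \<le> k" for j
  proof -
    have "W j = (\<Sum>S | S \<subseteq> D \<and> card S = j. q ^ (k - j))"
      unfolding W_def using that
      by (intro sum.cong refl) (auto simp: card_multiples_below linear_prod_neq_0 degree_linear_prod assms(4))
    then show ?thesis by (simp add: n_subsets assms(6))
  qed
  have "W (k + 1) = (\<Sum>s\<in>D. power_sum_count D (k + 1) s (c - (s - \<gamma>\<^sub>1)\<^sup>2))"
    unfolding W_def sum_power_sum_count_parabola[symmetric] c_def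
    by (intro sum.cong refl card_multiples_almost_full) (auto simp: two_neq_0)
  then have W1: "\<bar>real (W (k + 1)) - real (n choose (k + 1)) / real n\<bar> \<le> sqrt (real n) * A (k + 1)"
    using parabola_count_error[OF assms(7) c, of "k + 1"] by (simp only: A_def assms(6))
  have "W (k + 2) = (\<Sum>S | S \<subseteq> D \<and> card S = k + 2.
      if (\<Sum>x\<in>S. x) = \<gamma>\<^sub>1 \<and> (\<Sum>x\<in>S. x\<^sup>2) = c then 1 else 0)"
    unfolding W_def c_def by (intro sum.cong refl card_multiples_full) (auto simp: two_neq_0)
  also have "\<dots> = power_sum_count D (k + 2) \<gamma>\<^sub>1 c"
    unfolding power_sum_count_def by (simp add: sum.inter_filter[symmetric] conj_assoc)
  finally have W2: "\<bar>real (W (k + 2)) - real (n choose (k + 2)) / (real n)\<^sup>2\<bar> \<le> A (k + 2)"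
    using power_sum_count_error[OF assms(7) c, of "k + 2"] by (simp only: A_def assms(6))

  define \<epsilon> where "\<epsilon> j = (-1::real) ^ (j + r) * real (j choose r)" for j
  \<comment> \<open>Levels j \<le> k of the sieve are exact, so only j = k + 1 and j = k + 2
    contribute errors. Their weights have modulus (j choose r), which gives the binomial factors in
    the bound.\<close>
  define E where "E = \<epsilon> (k + 1) * (real (W (k + 1)) - real (n choose (k + 1)) / real n)
    + \<epsilon> (k + 2) * (real (W (k + 2)) - real (n choose (k + 2)) / (real n)\<^sup>2)"
  define M where "M = real q powi (int k - int r) * binom (real n) (int r) *
      (\<Sum>j\<in>{0..int k - int r}. (- real q) powi (- j) * binom (real n - real r) j)"
  have "(\<Sum>j\<le>k. \<epsilon> j * real (W j)) =
      (\<Sum>j\<le>k. (-1) ^ (j + r) * real (j choose r) * (real (n choose j) * real q ^ (k - j)))"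
    by (intro sum.cong refl) (simp add: W_small \<epsilon>_def)
  then have M: "(\<Sum>j\<le>k. \<epsilon> j * real (W j)) = M"
    unfolding M_def sieve_main_term[OF q0] .
  have "real (N_count D k f r) = (\<Sum>j\<le>k + 2. \<epsilon> j * real (W j))"
    unfolding N_count_eq_sieve \<epsilon>_def W_def ..
  then have "real (N_count D k f r) = M + \<epsilon> (k + 1) * real (W (k + 1)) + \<epsilon> (k + 2) * real (W (k + 2))"
    using M by (simp add: numeral_2_eq_2)
  then have N: "real (N_count D k f r) = M + \<epsilon> (k + 1) * real (n choose (k + 1)) * (1 / real n)
      + \<epsilon> (k + 2) * real (n choose (k + 2)) * (1 / (real n)\<^sup>2) + E"
    by (simp add: E_def algebra_simps)
  have \<epsilon>: "\<epsilon> j * real (n choose j) = (-1) powi (int j - int r) *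
      (binom (real n) (int r) * binom (real n - real r) (int j - int r))" for j
    unfolding \<epsilon>_def minus_one_power_choose by (simp only: mult.assoc choose_mult_binom)
  have int_eq: "int (k + 1) - int r = int k + 1 - int r" "int (k + 2) - int r = int k + 2 - int r"
    by simp_all
  have abs_\<epsilon>: "\<bar>\<epsilon> j\<bar> = binom (real j) (int r)" for j
    by (simp add: \<epsilon>_def abs_mult binom_def binomial_gbinomial[symmetric])
  have "\<bar>E\<bar> \<le> \<bar>\<epsilon> (k + 1)\<bar> * \<bar>real (W (k + 1)) - real (n choose (k + 1)) / real n\<bar>
      + \<bar>\<epsilon> (k + 2)\<bar> * \<bar>real (W (k + 2)) - real (n choose (k + 2)) / (real n)\<^sup>2\<bar>"
    unfolding E_def by (rule order.trans[OF abs_triangle_ineq]) (simp only: abs_mult order_refl)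
  also have "\<dots> \<le> \<bar>\<epsilon> (k + 1)\<bar> * (sqrt (real n) * A (k + 1)) + \<bar>\<epsilon> (k + 2)\<bar> * A (k + 2)"
    by (intro add_mono mult_left_mono W1 W2) simp_all
  also have "\<dots> = binom (real k + 2) (int r) * A (k + 2) + sqrt (real n) * binom (real k + 1) (int r) * A (k + 1)"
    unfolding abs_\<epsilon> by (simp add: mult_ac add_ac)
  finally have "\<bar>E\<bar> \<le> binom (real k + 2) (int r) * A (k + 2)
      + sqrt (real n) * binom (real k + 1) (int r) * A (k + 1)" .
  moreover have "real (N_count D k f r) = M
      + (- 1) powi (int k + 1 - int r) * (1 / real n) *
          binom (real n) (int r) * binom (real n - real r) (int k + 1 - int r)
      + (- 1) powi (int k + 2 - int r) * (1 / (real n)\<^sup>2) *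
          binom (real n) (int r) * binom (real n - real r) (int k + 2 - int r) + E"
    unfolding N \<epsilon> int_eq by (simp only: mult_ac)
  ultimately show ?thesis unfolding M_def A_def by blast
qed

end
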